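(* Let $K$ be a field, let $n \geq 3$ be an integer, and let $S = K[x_1,\ldots,x_n]$. (1) Let $I \subsetneq S$ be a monomial ideal with $I \neq (0)$, and put $d = \lim_{k \to \infty} \operatorname{depth} S/I^k$ and $r = \operatorname{dstab}(I)$. Then one of the following holds: - $0 \leq d \leq n-2$ and $r \geq 1$; - $d = n-1$ and $r = 1$. (2) Conversely, for any integers $d$ and $r$ satisfying one of the two conditions "$0 \leq d \leq n-2$ and $r \geq 1$" or "$d = n-1$ and $r = 1$", there exists a monomial ideal $J$ in $S$ such that $\lim_{k \to \infty} \operatorname{depth} S/J^k = d$ and $\operatorname{dstab}(J) = r$.
   Context: $S = K[x_1,\ldots,x_n]$ is the standard graded polynomial ring over a field $K$. A monomial ideal is an ideal generated by monomials. For a finitely generated graded $S$-module $M$, $\operatorname{depth} M$ denotes its depth with respect to the graded maximal ideal $(x_1,\ldots,x_n)$. The depth function of a homogeneous ideal $I$ is $k \mapsto \operatorname{depth} S/I^k$ ($k \geq 1$); it is known (Brodmann) that it is constant for $k \gg 0$, so the limit (the limit depth of $I$) exists. The depth stability number $\operatorname{dstab}(I)$ is the smallest integer $k_0 \geq 1$ such that $\operatorname{depth} S/I^{k_0} = \operatorname{depth} S/I^{k_0+1} = \operatorname{depth} S/I^{k_0+2} = \cdots$. *)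

theory Defs
  imports "HOL-Library.Poly_Mapping" "HOL-Library.Cardinality" "HOL-Library.Extended_Real"
begin

text \<open>The polynomial ring \<open>S = K[x\<^sub>1, \<dots>, x\<^sub>n]\<close>: the variables are indexed by a finite type \<open>'n\<close>
  with \<open>n = CARD('n)\<close>, an exponent vector is a map \<open>'n \<Rightarrow>\<^sub>0 nat\<close>, and multiplication on
  \<^typ>\<open>('n \<Rightarrow>\<^sub>0 nat) \<Rightarrow>\<^sub>0 'k\<close> is convolution of coefficients.\<close>

type_synonym ('n, 'k) mpoly_ring = "('n \<Rightarrow>\<^sub>0 nat) \<Rightarrow>\<^sub>0 'k"

text \<open>An ideal of a commutative ring is a submodule of the ring acting on itself by
  multiplication, so \<open>ideal.span B\<close> is the ideal generated by \<open>B\<close>.\<close>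

global_interpretation ideal: module "(*) :: 'a::comm_ring_1 \<Rightarrow> 'a \<Rightarrow> 'a"
  by standard (simp_all add: algebra_simps)

primrec ideal_power :: "'a::comm_ring_1 set \<Rightarrow> nat \<Rightarrow> 'a set" where
  "ideal_power I 0 = UNIV"
| "ideal_power I (Suc k) = ideal.span {a * b | a b. a \<in> I \<and> b \<in> ideal_power I k}"

definition monomial :: "('n \<Rightarrow>\<^sub>0 nat) \<Rightarrow> ('n::finite, 'k::field) mpoly_ring" where
  "monomial a = Poly_Mapping.single a 1"

definition var :: "'n \<Rightarrow> ('n::finite, 'k::field) mpoly_ring" where
  "var i = monomial (Poly_Mapping.single i 1)"

definition monomial_ideal :: "('n::finite, 'k::field) mpoly_ring set \<Rightarrow> bool" where
  "monomial_ideal I \<longleftrightarrow> (\<exists>A. I = ideal.span (monomial ` A))"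

definition graded_maximal_ideal :: "('n::finite, 'k::field) mpoly_ring set" where
  "graded_maximal_ideal = ideal.span (range var)"

text \<open>For \<open>M = S/J\<close> the module \<open>M/(f\<^sub>1, \<dots>, f\<^sub>i)M\<close> is \<open>S/(J + (f\<^sub>1, \<dots>, f\<^sub>i))\<close>. Multiplication by
  \<open>f\<close> is injective on \<open>S/Q\<close> iff \<open>f g \<in> Q\<close> implies \<open>g \<in> Q\<close>, and \<open>S/Q\<close> is nonzero iff \<open>Q \<noteq> S\<close>.\<close>

definition regular_sequence_quot :: "'a::comm_ring_1 set \<Rightarrow> 'a list \<Rightarrow> bool" where
  "regular_sequence_quot J fs \<longleftrightarrow>
     (\<forall>i<length fs. \<forall>g. fs ! i * g \<in> ideal.span (J \<union> set (take i fs)) \<longrightarrow>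
                        g \<in> ideal.span (J \<union> set (take i fs))) \<and>
     ideal.span (J \<union> set fs) \<noteq> UNIV"

text \<open>\<open>depth_quot J\<close> is the depth of \<open>S/J\<close>: the supremum of the lengths of \<open>S/J\<close>-regular sequences
  in the graded maximal ideal. The zero module has depth \<open>\<infinity>\<close>.\<close>

definition depth_quot :: "('n::finite, 'k::field) mpoly_ring set \<Rightarrow> enat" where
  "depth_quot J =
     (if J = UNIV then \<infinity>
      else SUP fs \<in> {fs. set fs \<subseteq> graded_maximal_ideal \<and> regular_sequence_quot J fs}.
             enat (length fs))"

definition depth_function :: "('n::finite, 'k::field) mpoly_ring set \<Rightarrow> nat \<Rightarrow> enat" where
  "depth_function I k = depth_quot (ideal_power I k)"

definition dstab :: "('n::finite, 'k::field) mpoly_ring set \<Rightarrow> nat" where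
  "dstab I = (LEAST k0. k0 \<ge> 1 \<and> (\<forall>k\<ge>k0. depth_function I k = depth_function I k0))"

end

theory Submission
  imports Defs "HOL-Library.FuncSet"
begin

text \<open>
  Monomial ideals are handled as up-closed sets of exponents, so that powers, membership and
  regularity of variables become combinatorial.

  Upper bound. If every \<open>x\<^sub>i\<close> with \<open>i \<in> A\<close> has a power annihilating the nonzero class of a monomial \<open>w\<close> in
  \<open>S/J\<close>, then \<open>depth S/J \<le> n - |A|\<close>: by Noetherianity one can divide \<open>w\<close> by the members of a regular sequence
  \<open>f\<^sub>1, \<dots>, f\<^sub>t\<close> until its class is locally nonzero modulo them, hence the \<open>f\<^sub>i\<close> are algebraically
  independent modulo the annihilator of \<open>w\<close>, and comparing the growth of \<open>K[f\<^sub>1, \<dots>, f\<^sub>t]\<close> with that of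
  \<open>S/(J : w)\<close> gives \<open>t \<le> n - |A|\<close>.

  Restriction. A non-principal monomial ideal admits such a \<open>w\<close> with \<open>|A| \<ge> 2\<close>, a principal one has depth
  \<open>n - 1\<close> by the regular sequence \<open>x\<^sub>j - x\<^sub>i\<close> (\<open>j \<noteq> i\<close>), and \<open>I\<close> is principal as soon as some power is.

  Realization. For \<open>d = n - 2\<close> the depth has to increase at the last step, which is achieved by an
  ideal whose powers \<open>I\<^sup>k\<close> become \<open>(x, y)\<^bsup>ck\<^esup>\<close> exactly for \<open>k \<ge> r\<close>. For \<open>d \<le> n - 3\<close> it decreases at the
  last step: \<open>y - z\<close> is regular on \<open>S/I\<^sup>k\<close> for \<open>k < r\<close>, and for \<open>k \<ge> r\<close> there is a socle element.
\<close>

text \<open>As a simplification rule, \<open>ideal.scale_scale\<close> is associativity oriented against \<open>mult.assoc\<close>.\<close>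

declare ideal.scale_scale [simp del]

abbreviation lookup :: "('a \<Rightarrow>\<^sub>0 'b::zero) \<Rightarrow> 'a \<Rightarrow> 'b" where "lookup \<equiv> Poly_Mapping.lookup"
abbreviation keys :: "('a \<Rightarrow>\<^sub>0 'b::zero) \<Rightarrow> 'a set" where "keys \<equiv> Poly_Mapping.keys"
abbreviation single :: "'a \<Rightarrow> 'b \<Rightarrow> 'a \<Rightarrow>\<^sub>0 'b::zero" where "single \<equiv> Poly_Mapping.single"

section \<open>Monomial ideals as up-closed sets of exponents\<close>

lemma sum_single_lookup: "(\<Sum>a\<in>keys p. single a (lookup p a)) = p"
proof (rule poly_mapping_eqI)
  fix k
  have "lookup (\<Sum>a\<in>keys p. single a (lookup p a)) k
      = (\<Sum>a\<in>keys p. if a = k then lookup p a else 0)"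
    by (simp add: lookup_sum lookup_single when_def)
  also have "\<dots> = lookup p k"
    by (simp add: sum.delta in_keys_iff)
  finally show "lookup (\<Sum>a\<in>keys p. single a (lookup p a)) k = lookup p k" .
qed

lemma lookup_single_mult:
  fixes p :: "('n \<Rightarrow>\<^sub>0 nat) \<Rightarrow>\<^sub>0 'k::comm_ring_1"
  shows "lookup (single e c * p) (e + a) = c * lookup p a"
proof -
  have "single e c * p = (\<Sum>b\<in>keys p. single (e + b) (c * lookup p b))"
    by (subst sum_single_lookup[symmetric, of p]) (simp add: sum_distrib_left mult_single)
  then show ?thesis
    by (simp add: lookup_sum lookup_single when_def sum.delta in_keys_iff)
qed

lemma lookup_single_mult_0:
  fixes p :: "('n \<Rightarrow>\<^sub>0 nat) \<Rightarrow>\<^sub>0 'k::comm_ring_1"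
  assumes "\<nexists>b. a = e + b"
  shows "lookup (single e c * p) a = 0"
proof -
  have "single e c * p = (\<Sum>b\<in>keys p. single (e + b) (c * lookup p b))"
    by (subst sum_single_lookup[symmetric, of p]) (simp add: sum_distrib_left mult_single)
  moreover have "e + b \<noteq> a" for b using assms by blast
  ultimately show ?thesis
    by (simp add: lookup_sum lookup_single when_def)
qed

lemma exponent_add_diff:
  fixes a b :: "'n \<Rightarrow>\<^sub>0 nat"
  assumes "\<And>i. lookup a i \<le> lookup b i"
  shows "a + (b - a) = b"
  by (rule poly_mapping_eqI) (simp add: lookup_add lookup_minus assms)

definition up_closed :: "('n \<Rightarrow>\<^sub>0 nat) set \<Rightarrow> bool" where
  "up_closed U \<longleftrightarrow> (\<forall>a\<in>U. \<forall>b. a + b \<in> U)"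

lemma up_closedD: "up_closed U \<Longrightarrow> a \<in> U \<Longrightarrow> a + b \<in> U"
  by (auto simp: up_closed_def)

lemma up_closed_mono:
  assumes "up_closed U" "a \<in> U" "\<And>i. lookup a i \<le> lookup b i"
  shows "b \<in> U"
  using up_closedD[OF assms(1,2), of "b - a"] exponent_add_diff[OF assms(3)] by simp

lemma up_closedI:
  assumes "\<And>a b. a \<in> U \<Longrightarrow> (\<And>i. lookup a i \<le> lookup b i) \<Longrightarrow> b \<in> U"
  shows "up_closed U"
  unfolding up_closed_def
proof safe
  fix a b assume "a \<in> U"
  then show "a + b \<in> U" by (rule assms) (simp add: lookup_add)
qed

lemma up_closed_sum:
  assumes "up_closed V"
  shows "up_closed {a + b | a b. a \<in> U \<and> b \<in> V}"
  unfolding up_closed_def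
proof safe
  fix a b c assume "a \<in> U" "b \<in> V"
  then show "\<exists>a' b'. a + b + c = a' + b' \<and> a' \<in> U \<and> b' \<in> V"
    using up_closedD[OF assms, of b c] by (intro exI[of _ a] exI[of _ "b + c"]) (simp add: add.assoc)
qed

lemma up_closed_multiples: "up_closed {a + b | a b. a \<in> A}"
  using up_closed_sum[of UNIV A] by (simp add: up_closed_def)

text \<open>The polynomials whose support lies in \<open>U\<close>. For up-closed \<open>U\<close>
  this is the monomial ideal with monomials \<open>x^u\<close>, \<open>u \<in> U\<close>, so
  membership is tested term by term; the empty set encodes the zero ideal.\<close>

definition exp_ideal :: "('n \<Rightarrow>\<^sub>0 nat) set \<Rightarrow> ('n::finite, 'k::field) mpoly_ring set" where
  "exp_ideal U = {p. keys p \<subseteq> U}"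

lemma subspace_exp_ideal:
  assumes "up_closed U"
  shows "ideal.subspace (exp_ideal U :: ('n::finite, 'k::field) mpoly_ring set)"
proof (rule ideal.subspaceI)
  fix p q :: "('n, 'k) mpoly_ring"
  assume p: "p \<in> exp_ideal U"
  have "b + a \<in> U" if "a \<in> keys p" for a b
    using that p up_closedD[OF assms, of a b] by (auto simp: exp_ideal_def add.commute)
  then have "{b + a | b a. b \<in> keys q \<and> a \<in> keys p} \<subseteq> U" by blast
  then show "q * p \<in> exp_ideal U"
    using keys_mult[of q p] by (simp add: exp_ideal_def)
  assume "q \<in> exp_ideal U"
  with p show "p + q \<in> exp_ideal U"
    using keys_add[of p q] by (auto simp: exp_ideal_def)
qed (simp add: exp_ideal_def)

lemma exp_ideal_subset:
  fixes Q :: "('n::finite, 'k::field) mpoly_ring set"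
  assumes "ideal.subspace Q" "\<And>a c. a \<in> U \<Longrightarrow> single a c \<in> Q"
  shows "exp_ideal U \<subseteq> Q"
proof
  fix p :: "('n, 'k) mpoly_ring"
  assume "p \<in> exp_ideal U"
  then have "(\<Sum>a\<in>keys p. single a (lookup p a)) \<in> Q"
    by (intro ideal.subspace_sum[OF assms(1)] assms(2)) (auto simp: exp_ideal_def)
  then show "p \<in> Q" by (simp add: sum_single_lookup)
qed

lemma single_mem_exp_ideal: "c \<noteq> 0 \<Longrightarrow> single a c \<in> exp_ideal U \<longleftrightarrow> a \<in> U"
  by (simp add: exp_ideal_def)

lemma span_exp_ideal: "up_closed U \<Longrightarrow> ideal.span (exp_ideal U) = exp_ideal U"
  by (simp only: ideal.span_eq_iff subspace_exp_ideal)

lemma span_monomials: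
  "ideal.span (monomial ` A :: ('n::finite, 'k::field) mpoly_ring set)
    = exp_ideal {a + b | a b. a \<in> A}"
proof
  let ?U = "{a + b | a b. a \<in> A}"
  have up: "up_closed ?U" by (rule up_closed_multiples)
  show "ideal.span (monomial ` A) \<subseteq> (exp_ideal ?U :: ('n, 'k) mpoly_ring set)"
  proof (rule ideal.span_minimal[OF _ subspace_exp_ideal[OF up]])
    show "monomial ` A \<subseteq> exp_ideal ?U"
      by (auto simp: monomial_def single_mem_exp_ideal) (metis add.right_neutral)
  qed
  show "exp_ideal ?U \<subseteq> ideal.span (monomial ` A :: ('n, 'k) mpoly_ring set)"
  proof (rule exp_ideal_subset[OF ideal.subspace_span])
    fix u and c :: 'k
    assume "u \<in> ?U"
    then obtain a b where u: "u = a + b" "a \<in> A" by blast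
    have "single u c = single b c * monomial a"
      by (simp add: u monomial_def mult_single add.commute)
    then show "single u c \<in> ideal.span (monomial ` A)"
      using u by (simp add: ideal.span_base ideal.span_scale)
  qed
qed

lemma monomial_ideal_exp_ideal:
  fixes I :: "('n::finite, 'k::field) mpoly_ring set"
  shows "monomial_ideal I \<longleftrightarrow> (\<exists>U. up_closed U \<and> I = exp_ideal U)"
proof
  assume "monomial_ideal I"
  then obtain A where "I = ideal.span (monomial ` A)" by (auto simp: monomial_ideal_def)
  then show "\<exists>U. up_closed U \<and> I = exp_ideal U"
    using span_monomials[of A, where 'k = 'k] up_closed_multiples[of A] by blast
next
  assume "\<exists>U. up_closed U \<and> I = exp_ideal U"
  then obtain U where U: "up_closed U" "I = exp_ideal U" by blast
  have "{a + b | a b. a \<in> U} = U"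
  proof safe
    show "\<exists>b c. a = b + c \<and> b \<in> U" if "a \<in> U" for a
      using that by (intro exI[of _ a] exI[of _ 0]) simp
  qed (use U(1) in \<open>simp add: up_closedD\<close>)
  then show "monomial_ideal I"
    unfolding monomial_ideal_def using span_monomials[of U, where 'k = 'k] U(2) by (intro exI[of _ U]) simp
qed

lemma zero_mem_up_closed: "up_closed U \<Longrightarrow> 0 \<in> U \<longleftrightarrow> U = UNIV"
  using up_closedD[of U 0] by auto

lemma exp_ideal_eq_UNIV:
  assumes "up_closed U"
  shows "(exp_ideal U :: ('n::finite, 'k::field) mpoly_ring set) = UNIV \<longleftrightarrow> 0 \<in> U"
proof
  assume "(exp_ideal U :: ('n, 'k) mpoly_ring set) = UNIV"
  then have "single 0 1 \<in> (exp_ideal U :: ('n, 'k) mpoly_ring set)" by simp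
  then show "0 \<in> U" by (simp add: exp_ideal_def)
qed (use assms in \<open>simp add: zero_mem_up_closed exp_ideal_def\<close>)

lemma exp_ideal_empty: "exp_ideal {} = {0}"
  by (auto simp: exp_ideal_def)

lemma up_closed_Un_var: "up_closed U \<Longrightarrow> up_closed (U \<union> {a. \<exists>b\<in>B. lookup a b > 0})"
  by (auto simp: up_closed_def lookup_add)

lemma single_eq_mult_var:
  fixes c :: "'k::field" and a :: "'n::finite \<Rightarrow>\<^sub>0 nat"
  assumes "lookup a b > 0"
  shows "single a c = single (a - single b 1) c * var b"
proof -
  have "single b 1 + (a - single b 1) = a"
    by (rule exponent_add_diff) (use assms in \<open>auto simp: lookup_single when_def\<close>)
  then have "(a - single b 1) + single b 1 = a" by (simp add: add.commute)
  then show ?thesis by (simp add: var_def monomial_def mult_single)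
qed

text \<open>Adding variables keeps the ideal monomial, so every intermediate quotient of a regular
  sequence of variables is again described by a set of exponents.\<close>

lemma span_exp_ideal_vars:
  assumes up: "up_closed U"
  shows "ideal.span (exp_ideal U \<union> var ` B)
    = (exp_ideal (U \<union> {a. \<exists>b\<in>B. lookup a b > 0}) :: ('n::finite, 'k::field) mpoly_ring set)"
    (is "_ = exp_ideal ?V")
proof
  show "ideal.span (exp_ideal U \<union> var ` B) \<subseteq> (exp_ideal ?V :: ('n, 'k) mpoly_ring set)"
  proof (rule ideal.span_minimal)
    show "exp_ideal U \<union> var ` B \<subseteq> (exp_ideal ?V :: ('n, 'k) mpoly_ring set)"
      by (auto simp: exp_ideal_def var_def monomial_def lookup_single when_def intro!: bexI)
  qed (rule subspace_exp_ideal[OF up_closed_Un_var[OF up]])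
  show "exp_ideal ?V \<subseteq> ideal.span (exp_ideal U \<union> var ` B :: ('n, 'k) mpoly_ring set)"
  proof (rule exp_ideal_subset[OF ideal.subspace_span])
    fix a and c :: 'k
    assume "a \<in> ?V"
    then consider "a \<in> U" | b where "b \<in> B" "lookup a b > 0" by auto
    then show "single a c \<in> ideal.span (exp_ideal U \<union> var ` B)"
    proof cases
      case 1
      then show ?thesis by (intro ideal.span_base) (simp add: exp_ideal_def)
    next
      case 2
      have "single (a - single b 1) c * var b \<in> ideal.span (exp_ideal U \<union> var ` B)"
        using 2(1) by (intro ideal.span_scale ideal.span_base) simp
      then show ?thesis by (simp only: single_eq_mult_var[OF 2(2), of c])
    qed
  qed
qed

section \<open>Powers of monomial ideals\<close>

primrec exp_power :: "('n \<Rightarrow>\<^sub>0 nat) set \<Rightarrow> nat \<Rightarrow> ('n \<Rightarrow>\<^sub>0 nat) set" where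
  "exp_power U 0 = UNIV"
| "exp_power U (Suc k) = {a + b | a b. a \<in> U \<and> b \<in> exp_power U k}"

lemma exp_power_SucI: "g \<in> U \<Longrightarrow> b \<in> exp_power U k \<Longrightarrow> g + b \<in> exp_power U (Suc k)"
  by auto

lemma exp_power_Suc_diffI:
  assumes "g \<in> U" "\<And>i. lookup g i \<le> lookup a i" "a - g \<in> exp_power U k"
  shows "a \<in> exp_power U (Suc k)"
  using exp_power_SucI[OF assms(1,3)] exponent_add_diff[OF assms(2)] by simp

lemma up_closed_exp_power: "up_closed U \<Longrightarrow> up_closed (exp_power U k)"
  by (induction k) (simp_all add: up_closed_sum, simp add: up_closed_def)

lemma exp_ideal_mult:
  assumes U: "up_closed U" and V: "up_closed V"
  shows "ideal.span {p * q | p q. p \<in> exp_ideal U \<and> q \<in> exp_ideal V}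
    = (exp_ideal {a + b | a b. a \<in> U \<and> b \<in> V} :: ('n::finite, 'k::field) mpoly_ring set)"
    (is "ideal.span ?P = exp_ideal ?W")
proof
  have up: "up_closed ?W"
    by (rule up_closed_sum[OF V])
  show "ideal.span ?P \<subseteq> exp_ideal ?W"
  proof (rule ideal.span_minimal[OF _ subspace_exp_ideal[OF up]])
    show "?P \<subseteq> exp_ideal ?W"
    proof safe
      fix p q :: "('n, 'k) mpoly_ring"
      assume "p \<in> exp_ideal U" "q \<in> exp_ideal V"
      then have "keys p \<subseteq> U" "keys q \<subseteq> V" by (simp_all add: exp_ideal_def)
      then have "keys (p * q) \<subseteq> ?W" using keys_mult[of p q] by fastforce
      then show "p * q \<in> exp_ideal ?W" by (simp add: exp_ideal_def)
    qed
  qed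
  show "exp_ideal ?W \<subseteq> ideal.span ?P"
  proof (rule exp_ideal_subset[OF ideal.subspace_span])
    fix u and c :: 'k
    assume "u \<in> ?W"
    then obtain a b where u: "u = a + b" "a \<in> U" "b \<in> V" by blast
    have "single u c = single a c * single b 1" by (simp add: u mult_single)
    moreover have "single a c \<in> exp_ideal U" "single b 1 \<in> (exp_ideal V :: ('n, 'k) mpoly_ring set)"
      using u by (auto simp: exp_ideal_def)
    ultimately show "single u c \<in> ideal.span ?P" by (intro ideal.span_base) blast
  qed
qed

lemma ideal_power_exp_ideal:
  assumes "up_closed U"
  shows "ideal_power (exp_ideal U) k = (exp_ideal (exp_power U k) :: ('n::finite, 'k::field) mpoly_ring set)"
proof (induction k)
  case (Suc k)
  then show ?case using exp_ideal_mult[OF assms up_closed_exp_power[OF assms, of k]] by simp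
qed (simp add: exp_ideal_def)

section \<open>Constant coefficients and the graded maximal ideal\<close>

lemma exponent_add_eq_0:
  fixes a b :: "'n \<Rightarrow>\<^sub>0 nat"
  shows "a + b = 0 \<longleftrightarrow> a = 0 \<and> b = 0"
  by (auto simp: poly_mapping_eq_iff fun_eq_iff lookup_add)

lemma exp_power_proper:
  assumes "0 \<notin> U" "k \<ge> 1"
  shows "0 \<notin> exp_power U k"
proof -
  obtain l where k: "k = Suc l" using assms(2) by (cases k) auto
  have "0 \<noteq> a + b" if "a \<in> U" for a b
    using that assms(1) exponent_add_eq_0[of a b] by auto
  then show ?thesis by (auto simp: k)
qed

text \<open>\<open>0 = a + b\<close> forces \<open>a = b = 0\<close>, so the constant coefficient is
  multiplicative. Hence polynomials with nonzero constant coefficient can serve as denominators of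
  the localization at the origin.\<close>

lemma lookup_mult_zero:
  fixes p q :: "('n \<Rightarrow>\<^sub>0 nat) \<Rightarrow>\<^sub>0 'k::comm_ring_1"
  shows "lookup (p * q) 0 = lookup p 0 * lookup q 0"
proof -
  have single: "lookup (single a (lookup p a) * q) 0 = (if a = 0 then lookup p 0 * lookup q 0 else 0)" for a
  proof (cases "a = 0")
    case True
    then show ?thesis using lookup_single_mult[of 0 "lookup p 0" q 0] by simp
  next
    case False
    then have "\<nexists>b. 0 = a + b" using exponent_add_eq_0[of a] by metis
    then show ?thesis using lookup_single_mult_0[of 0 a] False by simp
  qed
  have "p * q = (\<Sum>a\<in>keys p. single a (lookup p a) * q)"
    by (simp add: sum_distrib_right[symmetric] sum_single_lookup)
  then have "lookup (p * q) 0 = (\<Sum>a\<in>keys p. if a = 0 then lookup p 0 * lookup q 0 else 0)"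
    by (simp only: lookup_sum single)
  also have "\<dots> = lookup p 0 * lookup q 0"
    by (simp add: in_keys_iff)
  finally show ?thesis .
qed

lemma subspace_zero_constant: "ideal.subspace {p :: ('n::finite, 'k::field) mpoly_ring. lookup p 0 = 0}"
  by (rule ideal.subspaceI) (auto simp: lookup_add lookup_mult_zero)

lemma single_nonzero: "single i (Suc 0) \<noteq> 0"
  by (metis lookup_single_eq lookup_zero nat.distinct(1))

lemma graded_maximal_ideal_constant:
  "p \<in> graded_maximal_ideal \<Longrightarrow> lookup p 0 = 0"
proof -
  have "graded_maximal_ideal \<subseteq> {p :: ('a, 'b) mpoly_ring. lookup p 0 = 0}"
    unfolding graded_maximal_ideal_def
    by (rule ideal.span_minimal[OF _ subspace_zero_constant])
      (auto simp: var_def monomial_def lookup_single when_def single_nonzero)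
  then show "p \<in> graded_maximal_ideal \<Longrightarrow> lookup p 0 = 0" by blast
qed

lemma var_graded_maximal_ideal: "var i \<in> graded_maximal_ideal"
  unfolding graded_maximal_ideal_def by (rule ideal.span_base) simp


section \<open>Noetherianity\<close>

text \<open>A monotone subsequence is nondecreasing or nonincreasing, and in the second case it is
  constant from the index of its minimum on.\<close>

lemma nat_seq_nondecreasing_subseq:
  fixes s :: "nat \<Rightarrow> nat"
  shows "\<exists>g :: nat \<Rightarrow> nat. strict_mono g \<and> mono (\<lambda>k. s (g k))"
proof -
  obtain g where g: "strict_mono g" "monoseq (\<lambda>k. s (g k))"
    using seq_monosub[of s] by blast
  show ?thesis
  proof (cases "\<forall>m n. m \<le> n \<longrightarrow> s (g m) \<le> s (g n)")
    case True
    then show ?thesis using g(1) by (intro exI[of _ g]) (simp add: mono_def)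
  next
    case False
    then have dec: "s (g n) \<le> s (g m)" if "m \<le> n" for m n
      using g(2) that by (auto simp: monoseq_def)
    obtain N where N: "\<And>n. s (g N) \<le> s (g n)"
      using ex_has_least_nat[of "\<lambda>_. True" 0 "\<lambda>n. s (g n)"] by auto
    have "s (g (N + k)) = s (g N)" for k
      using dec[of N "N + k"] N[of "N + k"] by simp
    moreover have "strict_mono (\<lambda>k. g (N + k))"
      using g(1) by (simp add: strict_mono_def)
    ultimately show ?thesis
      by (intro exI[of _ "\<lambda>k. g (N + k)"]) (simp add: mono_def)
  qed
qed

text \<open>Dickson's lemma: pass to subsequences that are nondecreasing in one variable after
  another, then compare the first two terms.\<close>

lemma dickson:
  fixes f :: "nat \<Rightarrow> 'n::finite \<Rightarrow>\<^sub>0 nat"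
  shows "\<exists>i j. i < j \<and> (\<forall>x. lookup (f i) x \<le> lookup (f j) x)"
proof -
  have "\<exists>g :: nat \<Rightarrow> nat. strict_mono g \<and> (\<forall>x\<in>X. mono (\<lambda>k. lookup (f (g k)) x))" if "finite X" for X
    using that
  proof (induction X)
    case empty
    then show ?case by (intro exI[of _ id]) (simp add: strict_mono_def)
  next
    case (insert x X)
    then obtain g :: "nat \<Rightarrow> nat" where g: "strict_mono g" "\<forall>x\<in>X. mono (\<lambda>k. lookup (f (g k)) x)" by blast
    obtain h :: "nat \<Rightarrow> nat" where h: "strict_mono h" "mono (\<lambda>k. lookup (f (g (h k))) x)"
      using nat_seq_nondecreasing_subseq[of "\<lambda>k. lookup (f (g k)) x"] by blast
    have "mono (\<lambda>k. lookup (f (g (h k))) y)" if "y \<in> X" for y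
      using g(2) that strict_mono_mono[OF h(1)] by (auto simp: mono_def)
    with h g(1) show ?case
      by (intro exI[of _ "\<lambda>k. g (h k)"]) (auto simp: strict_mono_def)
  qed
  from this[of UNIV] obtain g :: "nat \<Rightarrow> nat" where g: "strict_mono g" "\<And>x. mono (\<lambda>k. lookup (f (g k)) x)"
    by auto
  have "g 0 < g 1" using g(1) by (simp add: strict_mono_def)
  moreover have "lookup (f (g 0)) x \<le> lookup (f (g 1)) x" for x
    using monoD[OF g(2)[of x], of 0 1] by simp
  ultimately show ?thesis by blast
qed

text \<open>Renumbering the variables by natural numbers transports the lexicographic order, which is
  available for \<^typ>\<open>nat \<Rightarrow>\<^sub>0 nat\<close>, to the exponents.\<close>

definition lex_key :: "('n::finite \<Rightarrow>\<^sub>0 nat) \<Rightarrow> (nat \<Rightarrow>\<^sub>0 nat)" where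
  "lex_key a = (\<Sum>i\<in>UNIV. single (to_nat i) (lookup a i))"

lemma lookup_lex_key: "lookup (lex_key a) (to_nat i) = lookup a i"
proof -
  have "lookup (lex_key a) (to_nat i) = (\<Sum>j\<in>UNIV. if j = i then lookup a j else 0)"
    by (simp add: lex_key_def lookup_sum lookup_single when_def)
  then show ?thesis by simp
qed

lemma lex_key_inj: "lex_key a = lex_key b \<Longrightarrow> a = b"
  by (rule poly_mapping_eqI) (simp flip: lookup_lex_key)

lemma lex_key_add: "lex_key (a + b) = lex_key a + lex_key b"
  by (simp add: lex_key_def lookup_add single_add sum.distrib)

lemma lex_nonneg: "0 \<le> (x :: nat \<Rightarrow>\<^sub>0 nat)"
proof (rule ccontr)
  assume "\<not> 0 \<le> x"
  then have "x < 0" by simp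
  then have "less_fun (lookup x) (lookup 0)" by (simp add: less_poly_mapping.rep_eq)
  then show False by (auto simp: less_fun_def)
qed

lemma lex_key_mono:
  assumes "\<And>i. lookup a i \<le> lookup b i"
  shows "lex_key a \<le> lex_key b"
proof -
  have "lex_key a + 0 \<le> lex_key a + lex_key (b - a)"
    by (rule add_left_mono[OF lex_nonneg])
  then show ?thesis using exponent_add_diff[OF assms] by (simp flip: lex_key_add)
qed

text \<open>By Dickson's lemma an infinite descending chain would contain a later exponent that
  dominates an earlier one componentwise, and the lexicographic order is monotone for this
  relation.\<close>

lemma wf_lex_key: "wf {(a, b). lex_key a < lex_key (b :: 'n::finite \<Rightarrow>\<^sub>0 nat)}"
  unfolding wf_iff_no_infinite_down_chain
proof
  assume "\<exists>f :: nat \<Rightarrow> 'n \<Rightarrow>\<^sub>0 nat. \<forall>i. (f (Suc i), f i) \<in> {(a, b). lex_key a < lex_key b}"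
  then obtain f :: "nat \<Rightarrow> 'n \<Rightarrow>\<^sub>0 nat" where f: "\<And>i. lex_key (f (Suc i)) < lex_key (f i)" by auto
  obtain i j where ij: "i < j" "\<And>x. lookup (f i) x \<le> lookup (f j) x" using dickson[of f] by blast
  from ij(1) have "lex_key (f j) < lex_key (f i)"
  proof (induction j)
    case (Suc j)
    then show ?case using f[of j] by (cases "i = j") (auto simp: less_Suc_eq)
  qed simp
  with lex_key_mono[OF ij(2)] show False by simp
qed

lemma lex_minimal:
  assumes "a \<in> Q"
  shows "\<exists>b\<in>Q. \<forall>a. lex_key a < lex_key b \<longrightarrow> a \<notin> Q"
  using wf_lex_key assms unfolding wf_eq_minimal by (simp, blast)

section \<open>Leading exponents and the ascending chain condition\<close>

definition leading :: "('n::finite, 'k::field) mpoly_ring \<Rightarrow> ('n \<Rightarrow>\<^sub>0 nat) \<Rightarrow> bool" where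
  "leading p a \<longleftrightarrow> a \<in> keys p \<and> (\<forall>b\<in>keys p. lex_key b \<le> lex_key a)"

lemma leading_exists: "p \<noteq> 0 \<Longrightarrow> \<exists>a. leading p a"
proof -
  assume "p \<noteq> 0"
  then have "keys p \<noteq> {}" by simp
  then have "Max (lex_key ` keys p) \<in> lex_key ` keys p" by simp
  then obtain a where "a \<in> keys p" "lex_key a = Max (lex_key ` keys p)" by (auto simp: eq_commute)
  then show ?thesis by (auto simp: leading_def)
qed

text \<open>One step of polynomial division: the leading terms cancel, and all other exponents of
  either summand are smaller because the order is compatible with addition.\<close>

lemma leading_reduce:
  fixes p q :: "('n::finite, 'k::field) mpoly_ring"
  assumes p: "leading p a" and q: "leading q (a + c)"
    and r: "leading (q - single c (lookup q (a + c) / lookup p a) * p) b"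
  shows "lex_key b < lex_key (a + c)"
proof -
  let ?s = "single c (lookup q (a + c) / lookup p a) * p"
  have b: "b \<in> keys (q - ?s)" using r by (simp add: leading_def)
  have "lookup p a \<noteq> 0" using p by (simp add: leading_def in_keys_iff)
  then have "lookup (q - ?s) (a + c) = 0"
    using lookup_single_mult[of c "lookup q (a + c) / lookup p a" p a]
    by (simp add: lookup_minus add.commute[of c a])
  with b have ne: "b \<noteq> a + c" by (auto simp: in_keys_iff)
  have "lex_key b \<le> lex_key (a + c)"
  proof (cases "b \<in> keys q")
    case True
    then show ?thesis using q by (simp add: leading_def)
  next
    case False
    with b have "lookup ?s b \<noteq> 0" by (simp add: in_keys_iff lookup_minus)
    then obtain d where d: "b = c + d" using lookup_single_mult_0[of b c] by blast
    with \<open>lookup ?s b \<noteq> 0\<close> have "d \<in> keys p" by (auto simp: lookup_single_mult in_keys_iff)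
    then have "lex_key d \<le> lex_key a" using p by (simp add: leading_def)
    then have "lex_key c + lex_key d \<le> lex_key c + lex_key a" by (rule add_left_mono)
    then show ?thesis by (simp add: d lex_key_add add.commute)
  qed
  with ne lex_key_inj[of b "a + c"] show ?thesis by (auto simp: less_le)
qed

text \<open>Choose in each \<open>I (Suc n) - I n\<close> an element with minimal leading exponent.
  By Dickson's lemma one of these exponents divides a later one; reducing the later element by the
  earlier one keeps it outside of the smaller ideal but lowers its leading exponent.\<close>

lemma no_ascending_ideals:
  fixes I :: "nat \<Rightarrow> ('n::finite, 'k::field) mpoly_ring set"
  assumes I: "\<And>n. ideal.subspace (I n)" and asc: "\<And>n. I n \<subset> I (Suc n)"
  shows False
proof -
  let ?P = "\<lambda>n (p, a). p \<in> I (Suc n) - I n \<and> leading p a"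
  have "\<forall>n. \<exists>x. ?P n x \<and> (\<forall>y. ?P n y \<longrightarrow> \<not> lex_key (snd y) < lex_key (snd x))"
  proof
    fix n
    obtain p where p: "p \<in> I (Suc n) - I n" using asc[of n] by blast
    then have "p \<noteq> 0" using ideal.subspace_0[OF I[of n]] by auto
    then obtain a where "leading p a" using leading_exists by blast
    with p have "a \<in> {a. \<exists>p. ?P n (p, a)}" by auto
    from lex_minimal[OF this] obtain b where b: "b \<in> {a. \<exists>p. ?P n (p, a)}"
      "\<And>a. lex_key a < lex_key b \<Longrightarrow> a \<notin> {a. \<exists>p. ?P n (p, a)}"
      by blast
    from b(1) obtain q where "?P n (q, b)" by auto
    with b(2) show "\<exists>x. ?P n x \<and> (\<forall>y. ?P n y \<longrightarrow> \<not> lex_key (snd y) < lex_key (snd x))"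
      by (intro exI[of _ "(q, b)"]) auto
  qed
  from choice[OF this] obtain x
    where X: "\<forall>n. ?P n (x n) \<and> (\<forall>y. ?P n y \<longrightarrow> \<not> lex_key (snd y) < lex_key (snd (x n)))" ..
  have x: "?P n (x n)" "?P n y \<Longrightarrow> \<not> lex_key (snd y) < lex_key (snd (x n))" for n y
    by (rule conjunct1[OF spec[OF X]],
        rule mp[OF spec[OF conjunct2[OF spec[OF X]]]])
  obtain i j where ij: "i < j" "\<And>k. lookup (snd (x i)) k \<le> lookup (snd (x j)) k"
    using dickson[of "\<lambda>n. snd (x n)"] by blast
  obtain p a where p: "x i = (p, a)" by (cases "x i")
  obtain q b where q: "x j = (q, b)" by (cases "x j")
  define c where "c = b - a"
  have b: "b = a + c" using exponent_add_diff[of a b] ij(2) by (simp add: c_def p q)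
  have mono: "I m \<subseteq> I n" if "m \<le> n" for m n
    using that by (rule lift_Suc_mono_le[of I, rotated]) (use asc in blast)
  have pI: "p \<in> I j" "leading p a" using x(1)[of i] mono[of "Suc i" j] ij(1) by (auto simp: p)
  have qI: "q \<in> I (Suc j)" "q \<notin> I j" "leading q (a + c)" using x(1)[of j] by (auto simp: q b)
  define r where "r = q - single c (lookup q (a + c) / lookup p a) * p"
  have s: "single c (lookup q (a + c) / lookup p a) * p \<in> I j"
    by (rule ideal.subspace_scale[OF I pI(1)])
  have "r \<in> I (Suc j)"
    unfolding r_def using s mono[of j "Suc j"] by (intro ideal.subspace_diff[OF I] qI(1)) auto
  moreover have "r \<notin> I j"
  proof
    assume "r \<in> I j"
    from ideal.subspace_add[OF I this s] have "q \<in> I j" by (simp add: r_def)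
    with qI(2) show False by simp
  qed
  moreover from this have "r \<noteq> 0" using ideal.subspace_0[OF I[of j]] by auto
  then obtain d where d: "leading r d" using leading_exists by blast
  ultimately have "\<not> lex_key d < lex_key b" using x(2)[of j "(r, d)"] by (simp add: q)
  moreover have "lex_key d < lex_key b"
    using leading_reduce[OF pI(2) qI(3)] d by (simp add: r_def b)
  ultimately show False by simp
qed


section \<open>Powers of a regular sequence are linearly independent\<close>

lemma regular_sequence_Cons:
  assumes "regular_sequence_quot J (f # fs)"
  shows "\<And>g. f * g \<in> ideal.span J \<Longrightarrow> g \<in> ideal.span J"
    and "regular_sequence_quot (insert f J) fs"
proof -
  have *: "\<And>i g. i < length (f # fs) \<Longrightarrow> (f # fs) ! i * g \<in> ideal.span (J \<union> set (take i (f # fs)))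
      \<Longrightarrow> g \<in> ideal.span (J \<union> set (take i (f # fs)))"
    using assms unfolding regular_sequence_quot_def by blast
  show "\<And>g. f * g \<in> ideal.span J \<Longrightarrow> g \<in> ideal.span J" using *[of 0] by simp
  show "regular_sequence_quot (insert f J) fs"
    unfolding regular_sequence_quot_def
  proof safe
    fix i g assume "i < length fs" "fs ! i * g \<in> ideal.span (insert f J \<union> set (take i fs))"
    then show "g \<in> ideal.span (insert f J \<union> set (take i fs))" using *[of "Suc i" g] by simp
  next
    assume "ideal.span (insert f J \<union> set fs) = UNIV"
    then show False using assms by (simp add: regular_sequence_quot_def)
  qed
qed

text \<open>The next lemma plays the role of Krull's intersection theorem in the localization at the
  maximal ideal: a factor of \<open>f\<close> can only be split off finitely often.\<close>

lemma annihilator_step: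
  fixes J :: "('n::finite, 'k::field) mpoly_ring set"
  assumes f0: "lookup f 0 = 0"
    and reg: "\<And>g. f * g \<in> ideal.span J \<Longrightarrow> g \<in> ideal.span J"
    and z: "\<And>g. g * z \<in> ideal.span J \<Longrightarrow> lookup g 0 = 0"
  shows "\<exists>y. (\<forall>g. g * z \<in> ideal.span J \<longrightarrow> g * y \<in> ideal.span J) \<and>
             (\<forall>g. g * y \<in> ideal.span (insert f J) \<longrightarrow> lookup g 0 = 0)"
proof (rule ccontr)
  assume contr: "\<not> ?thesis"
  define Q where "Q = ideal.span J"
  have sub: "ideal.subspace Q" by (simp add: Q_def)
  note add = ideal.subspace_add[OF sub] and diff = ideal.subspace_diff[OF sub]
    and scale = ideal.subspace_scale[OF sub]
  \<comment> \<open>\<open>P y\<close>: the annihilator of \<open>z\<close> modulo \<open>Q\<close>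
    is contained in that of \<open>y\<close>, and \<open>y\<close> is nonzero in the localization at
    the origin, where elements with nonzero constant coefficient are units.\<close>
  define P where "P y \<longleftrightarrow> (\<forall>g. g * z \<in> Q \<longrightarrow> g * y \<in> Q) \<and> (\<forall>g. g * y \<in> Q \<longrightarrow> lookup g 0 = 0)" for y
  \<comment> \<open>\<open>R y y'\<close>: modulo \<open>Q\<close> and up to a unit of the
    localization, \<open>y\<close> equals \<open>y' * f\<close>.\<close>
  define R where "R y y' \<longleftrightarrow> (\<exists>u. lookup u 0 \<noteq> 0 \<and> u * y - y' * f \<in> Q)" for y y'
  have "\<exists>y'. P y' \<and> R y y'" if y: "P y" for y
  proof -
    have "\<not> (\<forall>g. g * y \<in> ideal.span (insert f J) \<longrightarrow> lookup g 0 = 0)"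
      using contr y unfolding P_def Q_def by blast
    then obtain u where u: "u * y \<in> ideal.span (insert f J)" "lookup u 0 \<noteq> 0" by blast
    from u(1) obtain y' where y': "u * y - y' * f \<in> Q"
      unfolding ideal.span_breakdown_eq Q_def by blast
    have iff: "g * y' \<in> Q \<longleftrightarrow> (g * u) * y \<in> Q" for g
    proof
      assume "g * y' \<in> Q"
      from add[OF scale[OF y', of g] scale[OF this, of f]]
      show "(g * u) * y \<in> Q" by (simp add: algebra_simps)
    next
      assume "(g * u) * y \<in> Q"
      from diff[OF this scale[OF y', of g]] have "f * (g * y') \<in> Q" by (simp add: algebra_simps)
      then show "g * y' \<in> Q" using reg unfolding Q_def by blast
    qed
    have "g * y' \<in> Q" if "g * z \<in> Q" for g
    proof -
      have "g * y \<in> Q" using y that by (simp add: P_def)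
      from scale[OF this, of u] show ?thesis by (simp add: iff algebra_simps)
    qed
    moreover have "lookup g 0 = 0" if "g * y' \<in> Q" for g
    proof -
      have "lookup (g * u) 0 = 0" using that y by (simp add: P_def iff)
      with u(2) show ?thesis by (simp add: lookup_mult_zero)
    qed
    ultimately have "P y'" by (simp add: P_def)
    then show ?thesis using u(2) y' unfolding R_def by blast
  qed
  moreover have "P z" using z by (simp add: P_def Q_def)
  ultimately obtain Y where Y: "\<And>n. P (Y n)" "\<And>n. R (Y n) (Y (Suc n))"
    using dependent_nat_choice[of "\<lambda>_. P" "\<lambda>_. R"] by blast
  \<comment> \<open>The contraction to the polynomial ring of the ideal generated by
    \<open>Q\<close> and \<open>Y n\<close> in the localization.\<close>
  define I where "I n = {g. \<exists>u a. lookup u 0 \<noteq> 0 \<and> u * g - a * Y n \<in> Q}" for n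
  have "ideal.subspace (I n)" for n
  proof (rule ideal.subspaceI)
    show "0 \<in> I n"
      unfolding I_def using ideal.subspace_0[OF sub]
      by (intro CollectI exI[of _ 1] exI[of _ 0]) simp
  next
    fix g h assume "g \<in> I n" "h \<in> I n"
    then obtain u a v b where *: "lookup u 0 \<noteq> 0" "u * g - a * Y n \<in> Q"
      "lookup v 0 \<noteq> 0" "v * h - b * Y n \<in> Q" by (auto simp: I_def)
    from add[OF scale[OF *(2), of v] scale[OF *(4), of u]]
    have "(u * v) * (g + h) - (v * a + u * b) * Y n \<in> Q" by (simp add: algebra_simps)
    moreover have "lookup (u * v) 0 \<noteq> 0" using * by (simp add: lookup_mult_zero)
    ultimately show "g + h \<in> I n" unfolding I_def by blast
  next
    fix c g assume "g \<in> I n"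
    then obtain u a where *: "lookup u 0 \<noteq> 0" "u * g - a * Y n \<in> Q" by (auto simp: I_def)
    from scale[OF *(2), of c] have "u * (c * g) - (c * a) * Y n \<in> Q" by (simp add: algebra_simps)
    with *(1) show "c * g \<in> I n" unfolding I_def by blast
  qed
  moreover have "I n \<subset> I (Suc n)" for n
  proof -
    obtain v where v: "lookup v 0 \<noteq> 0" "v * Y n - Y (Suc n) * f \<in> Q"
      using Y(2)[of n] by (auto simp: R_def)
    have "I n \<subseteq> I (Suc n)"
    proof
      fix g assume "g \<in> I n"
      then obtain u a where *: "lookup u 0 \<noteq> 0" "u * g - a * Y n \<in> Q" by (auto simp: I_def)
      from add[OF scale[OF *(2), of v] scale[OF v(2), of a]]
      have "(v * u) * g - (a * f) * Y (Suc n) \<in> Q" by (simp add: algebra_simps)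
      moreover have "lookup (v * u) 0 \<noteq> 0" using * v by (simp add: lookup_mult_zero)
      ultimately show "g \<in> I (Suc n)" unfolding I_def by blast
    qed
    moreover have "Y (Suc n) \<in> I (Suc n)"
      unfolding I_def using ideal.subspace_0[OF sub]
      by (intro CollectI exI[of _ 1]) simp
    \<comment> \<open>Otherwise \<open>Y n\<close> would be annihilated by
      \<open>v * w - f * a\<close>, whose constant coefficient is nonzero because that of
      \<open>f\<close> is 0.\<close>
    moreover have "Y (Suc n) \<notin> I n"
    proof
      assume "Y (Suc n) \<in> I n"
      then obtain w a where w: "lookup w 0 \<noteq> 0" "w * Y (Suc n) - a * Y n \<in> Q" by (auto simp: I_def)
      from add[OF scale[OF v(2), of w] scale[OF w(2), of f]]
      have "(v * w - f * a) * Y n \<in> Q" by (simp add: algebra_simps)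
      then have "lookup (v * w - f * a) 0 = 0" using Y(1)[of n] by (simp add: P_def)
      with v w f0 show False by (simp add: lookup_minus lookup_mult_zero)
    qed
    ultimately show ?thesis by blast
  qed
  ultimately show False by (rule no_ascending_ideals)
qed

section \<open>Linear independence of power products\<close>

fun power_list :: "'a::comm_ring_1 list \<Rightarrow> nat list \<Rightarrow> 'a" where
  "power_list (f # fs) (i # is) = f ^ i * power_list fs is"
| "power_list _ _ = 1"

definition bounded_lists :: "nat \<Rightarrow> nat \<Rightarrow> nat list set" where
  "bounded_lists L n = {is. set is \<subseteq> {..<L} \<and> length is = n}"

lemma finite_bounded_lists: "finite (bounded_lists L n)"
  unfolding bounded_lists_def by (rule finite_lists_length_eq) simp

lemma card_bounded_lists: "card (bounded_lists L n) = L ^ n"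
  using card_lists_length_eq[of "{..<L}" n] by (simp add: bounded_lists_def)

lemma sum_bounded_lists_Suc:
  "(\<Sum>is\<in>bounded_lists L (Suc n). h is) = (\<Sum>i<L. \<Sum>is\<in>bounded_lists L n. h (i # is))"
proof -
  have "bounded_lists L (Suc n) = (\<lambda>(i, is). i # is) ` ({..<L} \<times> bounded_lists L n)"
    unfolding bounded_lists_def by (auto simp: length_Suc_conv image_iff)
  moreover have "inj_on (\<lambda>(i, is). i # is) ({..<L} \<times> bounded_lists L n)"
    by (auto simp: inj_on_def)
  ultimately show ?thesis
    by (simp add: sum.reindex sum.cartesian_product case_prod_unfold comp_def)
qed

text \<open>Lowest power first: multiplied by \<open>y\<close> and read modulo \<open>f\<close>,
  only \<open>h 0\<close> survives. Once it vanishes, regularity cancels one \<open>f\<close> and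
  the index shifts.\<close>

lemma regular_powers_cancel:
  fixes J :: "'a::comm_ring_1 set"
  assumes reg: "\<And>g. f * g \<in> ideal.span J \<Longrightarrow> g \<in> ideal.span J"
    and zy: "\<And>g. g * z \<in> ideal.span J \<Longrightarrow> g * y \<in> ideal.span J"
    and "\<And>i. i < L \<Longrightarrow> h i * y \<in> ideal.span (insert f J) \<Longrightarrow> h i = 0"
    and "(\<Sum>i<L. f ^ i * h i) * z \<in> ideal.span J"
    and "i < L"
  shows "h i = 0"
  using assms(3-5)
proof (induction L arbitrary: h i)
  case (Suc L)
  let ?r = "\<Sum>i<L. f ^ i * h (Suc i)"
  have eq: "(\<Sum>i<Suc L. f ^ i * h i) = h 0 + f * ?r"
    by (simp add: sum.lessThan_Suc_shift sum_distrib_left mult.assoc del: sum.lessThan_Suc)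
  have "(h 0 + f * ?r) * y \<in> ideal.span J"
    using Suc.prems(2) unfolding eq by (rule zy)
  then have "(h 0 + f * ?r) * y \<in> ideal.span (insert f J)"
    using ideal.span_mono[of J "insert f J"] by blast
  moreover have "(?r * y) * f \<in> ideal.span (insert f J)"
    by (intro ideal.span_scale ideal.span_base) simp
  ultimately have "(h 0 + f * ?r) * y - (?r * y) * f \<in> ideal.span (insert f J)"
    by (rule ideal.span_diff)
  then have "h 0 * y \<in> ideal.span (insert f J)" by (simp add: algebra_simps)
  then have h0: "h 0 = 0" using Suc.prems(1)[of 0] by simp
  have "f * (?r * z) \<in> ideal.span J"
    using Suc.prems(2) unfolding eq h0 by (simp add: mult.assoc)
  then have "?r * z \<in> ideal.span J" by (rule reg)
  then have "h (Suc j) = 0" if "j < L" for j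
    using Suc.IH[of "\<lambda>i. h (Suc i)" j] Suc.prems(1) that by simp
  with h0 Suc.prems(3) show ?case by (cases i) auto
qed simp

text \<open>Induction along the sequence: when \<open>f\<close> moves into the ideal,
  \<open>z\<close> is replaced by the element \<open>y\<close> of \<open>annihilator_step\<close>.
  The hypothesis on \<open>z\<close> says that it is nonzero in the localization at the
  origin.\<close>

lemma regular_powers_independent:
  fixes J :: "('n::finite, 'k::field) mpoly_ring set"
  assumes "regular_sequence_quot J fs" "\<And>f. f \<in> set fs \<Longrightarrow> lookup f 0 = 0"
    and "\<And>g. g * z \<in> ideal.span J \<Longrightarrow> lookup g 0 = 0"
    and "(\<Sum>is\<in>bounded_lists L (length fs). single 0 (c is) * power_list fs is) * z \<in> ideal.span J"
    and "is \<in> bounded_lists L (length fs)"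
  shows "c is = 0"
  using assms
proof (induction fs arbitrary: J z c "is")
  case Nil
  have "bounded_lists L 0 = {[]}" by (auto simp: bounded_lists_def)
  with Nil.prems(3)[of "single 0 (c [])"] Nil.prems(4,5) show ?case by simp
next
  case (Cons f fs)
  note reg = regular_sequence_Cons[OF Cons.prems(1)]
  obtain y where y: "\<And>g. g * z \<in> ideal.span J \<Longrightarrow> g * y \<in> ideal.span J"
    "\<And>g. g * y \<in> ideal.span (insert f J) \<Longrightarrow> lookup g 0 = 0"
    using annihilator_step[of f J z, OF _ reg(1) Cons.prems(3)] Cons.prems(2)[of f] by auto
  define h where "h i = (\<Sum>is\<in>bounded_lists L (length fs). single 0 (c (i # is)) * power_list fs is)" for i
  have IH: "c (i # js) = 0" if "h i * y \<in> ideal.span (insert f J)" "js \<in> bounded_lists L (length fs)" for i js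
    by (rule Cons.IH[OF reg(2) _ y(2), where c = "\<lambda>is. c (i # is)"])
      (use Cons.prems(2) that in \<open>simp_all add: h_def\<close>)
  have hy: "h i = 0" if "h i * y \<in> ideal.span (insert f J)" for i
    unfolding h_def using IH[OF that] by simp
  have sum_eq: "(\<Sum>is\<in>bounded_lists L (length (f # fs)). single 0 (c is) * power_list (f # fs) is)
      = (\<Sum>i<L. f ^ i * h i)"
    by (simp add: sum_bounded_lists_Suc h_def sum_distrib_left mult_ac)
  have h0: "h i = 0" if "i < L" for i
    by (rule regular_powers_cancel[of f J z y L h i, OF reg(1) y(1) hy _ that])
      (use Cons.prems(4) in \<open>simp_all only: sum_eq\<close>)
  obtain i js where "is": "is = i # js" "i < L" "js \<in> bounded_lists L (length fs)"
    using Cons.prems(5) by (auto simp: bounded_lists_def length_Suc_conv)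
  show ?case
    unfolding "is"(1) by (rule IH[OF _ "is"(3)]) (simp add: h0[OF "is"(2)] ideal.span_zero)
qed


section \<open>An upper bound for the depth\<close>

lemma lookup_scalar_mult:
  fixes p :: "('n \<Rightarrow>\<^sub>0 nat) \<Rightarrow>\<^sub>0 'k::comm_ring_1"
  shows "lookup (single 0 c * p) a = c * lookup p a"
  using lookup_single_mult[of 0 c p a] by simp

text \<open>Comparison of dimensions over \<open>'k\<close>: the independent vectors lie in the span
  of the monomials with exponents in \<open>R\<close>. Scalars are embedded as the constants
  \<open>single 0 c\<close>.\<close>

lemma card_independent_family_le:
  fixes v :: "'b \<Rightarrow> ('n \<Rightarrow>\<^sub>0 nat) \<Rightarrow>\<^sub>0 'k::field"
  assumes T: "finite T" and R: "finite R" and keys: "\<And>t. t \<in> T \<Longrightarrow> keys (v t) \<subseteq> R"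
    and ind: "\<And>c t. (\<Sum>t\<in>T. single 0 (c t) * v t) = 0 \<Longrightarrow> t \<in> T \<Longrightarrow> c t = 0"
  shows "card T \<le> card R"
proof -
  interpret vs: vector_space "\<lambda>(c::'k) (p :: ('n \<Rightarrow>\<^sub>0 nat) \<Rightarrow>\<^sub>0 'k). single 0 c * p"
    by standard (simp_all add: distrib_left distrib_right single_add mult_single flip: mult.assoc)
  have inj: "inj_on v T"
  proof (rule inj_onI)
    fix a b assume ab: "a \<in> T" "b \<in> T" "v a = v b"
    define c :: "'b \<Rightarrow> 'k" where "c t = (if t = a then 1 else 0) - (if t = b then 1 else 0)" for t
    have "single 0 (c t) * v t = (if t = a then v t else 0) - (if t = b then v t else 0)" for t
      by (simp add: c_def single_uminus)
    then have "(\<Sum>t\<in>T. single 0 (c t) * v t) = 0"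
      using ab T by (simp add: sum_subtractf)
    from ind[OF this ab(1)] show "a = b" by (simp add: c_def split: if_splits)
  qed
  have "vs.independent (v ` T)"
  proof
    assume "vs.dependent (v ` T)"
    then obtain u where u: "\<exists>x\<in>v ` T. u x \<noteq> 0" "(\<Sum>x\<in>v ` T. single 0 (u x) * x) = 0"
      unfolding vs.dependent_finite[OF finite_imageI[OF T]] by blast
    from u(2) have "(\<Sum>t\<in>T. single 0 (u (v t)) * v t) = 0"
      by (simp add: sum.reindex[OF inj])
    from ind[OF this] u(1) show False by auto
  qed
  moreover have "v ` T \<subseteq> vs.span ((\<lambda>a. single a 1) ` R)"
  proof safe
    fix t assume t: "t \<in> T"
    have "single a (lookup (v t) a) \<in> vs.span ((\<lambda>a. single a 1) ` R)" if "a \<in> R" for a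
    proof -
      have "single 0 (lookup (v t) a) * single a 1 \<in> vs.span ((\<lambda>a. single a 1) ` R)"
        using that by (intro vs.span_scale vs.span_base) simp
      then show ?thesis by (simp add: mult_single)
    qed
    then have "(\<Sum>a\<in>keys (v t). single a (lookup (v t) a)) \<in> vs.span ((\<lambda>a. single a 1) ` R)"
      using keys[OF t] by (intro vs.span_sum) blast
    then show "v t \<in> vs.span ((\<lambda>a. single a 1) ` R)" by (simp only: sum_single_lookup)
  qed
  ultimately have "card (v ` T) \<le> card ((\<lambda>a. single a 1 :: ('n \<Rightarrow>\<^sub>0 nat) \<Rightarrow>\<^sub>0 'k) ` R)"
    using vs.independent_span_bound[of "(\<lambda>a. single a 1) ` R" "v ` T"] R by simp
  then show ?thesis using card_image[OF inj] card_image_le[OF R, of "\<lambda>a. single a 1 :: ('n \<Rightarrow>\<^sub>0 nat) \<Rightarrow>\<^sub>0 'k"]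
    by linarith
qed

section \<open>Degrees in each variable and counting in boxes\<close>

definition degrees_le :: "nat \<Rightarrow> (('n \<Rightarrow>\<^sub>0 nat) \<Rightarrow>\<^sub>0 'k::zero) \<Rightarrow> bool" where
  "degrees_le D p \<longleftrightarrow> (\<forall>a\<in>keys p. \<forall>i. lookup a i \<le> D)"

lemma degrees_le_mult:
  fixes p q :: "('n \<Rightarrow>\<^sub>0 nat) \<Rightarrow>\<^sub>0 'k::comm_ring_1"
  assumes "degrees_le D p" "degrees_le E q"
  shows "degrees_le (D + E) (p * q)"
  unfolding degrees_le_def
proof safe
  fix a i assume "a \<in> keys (p * q)"
  then obtain b c where "a = b + c" "b \<in> keys p" "c \<in> keys q" using keys_mult[of p q] by blast
  then show "lookup a i \<le> D + E" using assms by (simp add: lookup_add degrees_le_def add_mono)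
qed

lemma degrees_le_1: "degrees_le D (1 :: ('n \<Rightarrow>\<^sub>0 nat) \<Rightarrow>\<^sub>0 'k::comm_ring_1)"
  by (simp add: degrees_le_def)

lemma degrees_le_power:
  fixes p :: "('n \<Rightarrow>\<^sub>0 nat) \<Rightarrow>\<^sub>0 'k::comm_ring_1"
  assumes "degrees_le D p"
  shows "degrees_le (n * D) (p ^ n)"
proof (induction n)
  case (Suc n)
  then show ?case using degrees_le_mult[OF assms Suc.IH] by simp
qed (simp add: degrees_le_1)

lemma degrees_le_mono: "degrees_le D p \<Longrightarrow> D \<le> E \<Longrightarrow> degrees_le E p"
  unfolding degrees_le_def using order_trans by blast

lemma degrees_le_power_list:
  fixes fs :: "(('n \<Rightarrow>\<^sub>0 nat) \<Rightarrow>\<^sub>0 'k::comm_ring_1) list"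
  assumes "\<And>f. f \<in> set fs \<Longrightarrow> degrees_le D f" "is \<in> bounded_lists L (length fs)"
  shows "degrees_le (length fs * (L * D)) (power_list fs is)"
  using assms
proof (induction fs arbitrary: "is")
  case (Cons f fs)
  obtain i js where "is": "is = i # js" "i < L" "js \<in> bounded_lists L (length fs)"
    using Cons.prems(2) by (auto simp: bounded_lists_def length_Suc_conv)
  have "degrees_le (L * D) (f ^ i)"
    using degrees_le_power[of D f i] Cons.prems(1) "is"(2) by (auto elim!: degrees_le_mono)
  moreover have "degrees_le (length fs * (L * D)) (power_list fs js)"
    using Cons.IH Cons.prems(1) "is"(3) by simp
  ultimately show ?case using degrees_le_mult by (fastforce simp: "is"(1))
qed (simp add: degrees_le_1)

lemma degrees_le_exists:
  fixes F :: "(('n::finite \<Rightarrow>\<^sub>0 nat) \<Rightarrow>\<^sub>0 'k::zero) set"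
  assumes "finite F"
  shows "\<exists>D. \<forall>f\<in>F. degrees_le D f"
proof -
  let ?X = "\<Union>f\<in>F. \<Union>a\<in>keys f. Set.range (lookup a)"
  have "finite ?X" using assms by simp
  then have "\<forall>f\<in>F. degrees_le (Max ?X) f"
    unfolding degrees_le_def by (auto intro!: Max_ge)
  then show ?thesis ..
qed

text \<open>If the \<open>N\<close>-th power of each variable in \<open>A\<close> annihilates the
  class of \<open>x^w\<close>, these are the only exponents of degree at most \<open>D\<close> in
  each variable whose monomials can fail to annihilate it.\<close>

definition box :: "'n set \<Rightarrow> nat \<Rightarrow> nat \<Rightarrow> ('n::finite \<Rightarrow>\<^sub>0 nat) set" where
  "box A N D = {b. (\<forall>i. lookup b i \<le> D) \<and> (\<forall>i\<in>A. lookup b i < N)}"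

lemma finite_card_box:
  fixes A :: "'n::finite set"
  shows "finite (box A N D) \<and> card (box A N D) \<le> N ^ card A * Suc D ^ (CARD('n) - card A)"
proof -
  let ?P = "PiE UNIV (\<lambda>i. if i \<in> A then {..<N} else {..D})"
  have fin: "finite ?P" by (intro finite_PiE) auto
  have sub: "lookup ` box A N D \<subseteq> ?P"
    by (auto simp: box_def PiE_def Pi_def extensional_def)
  have inj: "inj_on lookup (box A N D)" by (auto simp: inj_on_def lookup_inject)
  have "card ?P = (\<Prod>i\<in>UNIV. if i \<in> A then N else Suc D)"
    by (subst card_PiE) (auto intro!: prod.cong)
  also have "\<dots> = N ^ card A * Suc D ^ card (- A)"
    by (subst prod.If_cases) (simp_all add: Compl_eq)
  also have "card (- A) = CARD('n) - card A" by (simp add: Compl_eq_Diff_UNIV card_Diff_subset)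
  finally show ?thesis
    using sub fin inj card_mono[OF fin sub] card_image[OF inj] finite_imageD[OF finite_subset[OF sub fin] inj]
    by simp
qed

definition truncate :: "'a set \<Rightarrow> ('a \<Rightarrow>\<^sub>0 'k::comm_monoid_add) \<Rightarrow> ('a \<Rightarrow>\<^sub>0 'k)" where
  "truncate R p = (\<Sum>a\<in>R. single a (lookup p a))"

lemma lookup_truncate: "finite R \<Longrightarrow> lookup (truncate R p) b = (if b \<in> R then lookup p b else 0)"
proof -
  assume R: "finite R"
  have "lookup (truncate R p) b = (\<Sum>a\<in>R. if a = b then lookup p a else 0)"
    by (simp add: truncate_def lookup_sum lookup_single when_def)
  with R show ?thesis by simp
qed

text \<open>For \<open>t > e\<close> the inequality already fails at a single \<open>L\<close>
  exceeding \<open>C * Suc c ^ e\<close>.\<close>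

lemma power_growth_exponent_le:
  fixes C c t e :: nat
  assumes "\<And>L. L ^ t \<le> C * Suc (c * L) ^ e"
  shows "t \<le> e"
proof (rule ccontr)
  assume "\<not> t \<le> e"
  define L where "L = Suc (C * Suc c ^ e)"
  have "L ^ Suc e \<le> L ^ t" using \<open>\<not> t \<le> e\<close> by (intro power_increasing) (auto simp: L_def)
  also have "\<dots> \<le> C * Suc (c * L) ^ e" by (rule assms)
  also have "\<dots> \<le> C * (Suc c * L) ^ e"
    by (intro mult_left_mono power_mono) (auto simp: L_def)
  also have "\<dots> = (C * Suc c ^ e) * L ^ e" by (simp only: power_mult_distrib mult.assoc)
  finally have "L * L ^ e \<le> (C * Suc c ^ e) * L ^ e" by simp
  then have "L \<le> C * Suc c ^ e" by (subst (asm) mult_le_cancel2) (auto simp: L_def)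
  then show False by (simp add: L_def)
qed

text \<open>The powers \<open>f\<^sup>a\<close> with exponents below \<open>L\<close> stay independent modulo the annihilator of the
  monomial with exponent \<open>w\<close>, while the residue classes of polynomials of degree \<open>O(L)\<close> modulo
  that annihilator span a space of dimension \<open>O(L\<^bsup>n - |A|\<^esup>)\<close>.\<close>

lemma regular_sequence_length_le:
  fixes fs :: "('n::finite, 'k::field) mpoly_ring list"
  assumes up: "up_closed U" and w: "w \<notin> U"
    and A: "\<And>i. i \<in> A \<Longrightarrow> \<exists>N. w + single i N \<in> U"
    and fs: "\<And>f. f \<in> set fs \<Longrightarrow> lookup f 0 = 0" "regular_sequence_quot (exp_ideal U) fs"
  shows "length fs \<le> CARD('n) - card A"
proof -
  let ?z = "single w 1 :: ('n, 'k) mpoly_ring"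
  have span: "ideal.span (exp_ideal U) = (exp_ideal U :: ('n, 'k) mpoly_ring set)"
    by (rule span_exp_ideal[OF up])
  have zmem: "g * ?z \<in> exp_ideal U" if "\<And>a. a \<in> keys g \<Longrightarrow> w + a \<in> U" for g
    unfolding exp_ideal_def
  proof safe
    fix b assume "b \<in> keys (g * ?z)"
    then have "lookup (?z * g) b \<noteq> 0" by (simp add: in_keys_iff mult.commute)
    then obtain a where a: "b = w + a" using lookup_single_mult_0[of b w 1 g] by blast
    with \<open>lookup (?z * g) b \<noteq> 0\<close> have "a \<in> keys g" by (simp add: lookup_single_mult in_keys_iff)
    with that a show "b \<in> U" by simp
  qed
  \<comment> \<open>The coefficient of \<open>g * ?z\<close> at \<open>w\<close> is the constant
    coefficient of \<open>g\<close>, and \<open>w\<close> lies outside of \<open>U\<close>.\<close>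
  have z: "lookup g 0 = 0" if "g * ?z \<in> ideal.span (exp_ideal U)" for g :: "('n, 'k) mpoly_ring"
  proof (rule ccontr)
    assume "lookup g 0 \<noteq> 0"
    then have "lookup (?z * g) (w + 0) \<noteq> 0" by (simp only: lookup_single_mult) simp
    then have "w \<in> keys (g * ?z)" by (simp add: in_keys_iff mult.commute)
    moreover have "g * ?z \<in> exp_ideal U" using that by (simp only: span)
    ultimately show False using w by (auto simp: exp_ideal_def)
  qed
  obtain M where M: "\<forall>i\<in>A. w + single i (M i) \<in> U" using bchoice[of A "\<lambda>i N. w + single i N \<in> U"] A by auto
  define N where "N = Max (insert 0 (M ` A))"
  have N: "w + b \<in> U" if "i \<in> A" "N \<le> lookup b i" for b i
  proof (rule up_closed_mono[OF up])
    show "w + single i (M i) \<in> U" using M that by blast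
    have "M i \<le> N" unfolding N_def using that by (intro Max_ge) auto
    then show "lookup (w + single i (M i)) j \<le> lookup (w + b) j" for j
      using that by (auto simp: lookup_add lookup_single when_def)
  qed
  obtain D where D: "\<And>f. f \<in> set fs \<Longrightarrow> degrees_le D f" using degrees_le_exists[of "set fs"] by auto
  have "L ^ length fs \<le> N ^ card A * Suc ((length fs * D) * L) ^ (CARD('n) - card A)" for L
  proof -
    define R where "R = box A N (length fs * (L * D))"
    have R: "finite R" "card R \<le> N ^ card A * Suc (length fs * (L * D)) ^ (CARD('n) - card A)"
      using finite_card_box[of A N "length fs * (L * D)"] by (simp_all add: R_def)
    let ?T = "bounded_lists L (length fs)"
    \<comment> \<open>Truncation to the box keeps the products independent: an exponent outside of
      \<open>R\<close> but within the degree bound has an entry at least \<open>N\<close> in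
      \<open>A\<close>, so its monomial annihilates \<open>?z\<close>.\<close>
    have "card ?T \<le> card R"
    proof (rule card_independent_family_le[OF finite_bounded_lists R(1)])
      show "keys (truncate R (power_list fs is)) \<subseteq> R" for "is"
        by (auto simp: in_keys_iff lookup_truncate[OF R(1)] split: if_splits)
    next
      fix c :: "nat list \<Rightarrow> 'k" and js
      assume 0: "(\<Sum>is\<in>?T. single 0 (c is) * truncate R (power_list fs is)) = 0" and js: "js \<in> ?T"
      define q where "q = (\<Sum>is\<in>?T. single 0 (c is) * power_list fs is)"
      have qR: "lookup q b = 0" if "b \<in> R" for b
      proof -
        have "lookup q b = lookup (\<Sum>is\<in>?T. single 0 (c is) * truncate R (power_list fs is)) b"
          using that by (simp add: q_def lookup_sum lookup_scalar_mult lookup_truncate[OF R(1)])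
        then show ?thesis by (simp add: 0)
      qed
      have qD: "lookup q b = 0" if "\<not> (\<forall>i. lookup b i \<le> length fs * (L * D))" for b
      proof -
        have "lookup (power_list fs is) b = 0" if "is \<in> ?T" for "is"
          using degrees_le_power_list[OF D that] \<open>\<not> (\<forall>i. _)\<close> by (auto simp: degrees_le_def in_keys_iff)
        then show ?thesis by (simp add: q_def lookup_sum lookup_scalar_mult)
      qed
      have "q * ?z \<in> exp_ideal U"
      proof (rule zmem)
        fix b assume "b \<in> keys q"
        then have "lookup q b \<noteq> 0" by (simp add: in_keys_iff)
        with qR qD have "b \<notin> R" "\<forall>i. lookup b i \<le> length fs * (L * D)" by blast+
        then obtain i where "i \<in> A" "N \<le> lookup b i" by (auto simp: R_def box_def not_less)
        then show "w + b \<in> U" by (rule N)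
      qed
      then show "c js = 0"
        using regular_powers_independent[OF fs(2,1) z _ js, where c = c] unfolding span q_def by blast
    qed
    with R(2) show ?thesis by (simp add: card_bounded_lists mult.assoc mult.commute[of D L])
  qed
  then show ?thesis by (rule power_growth_exponent_le)
qed

lemma depth_quot_le:
  assumes up: "up_closed U" and w: "w \<notin> U"
    and A: "\<And>i. i \<in> A \<Longrightarrow> \<exists>N. w + single i N \<in> U"
  shows "depth_quot (exp_ideal U :: ('n::finite, 'k::field) mpoly_ring set) \<le> enat (CARD('n) - card A)"
proof -
  have "(exp_ideal U :: ('n, 'k) mpoly_ring set) \<noteq> UNIV"
    using w by (simp add: exp_ideal_eq_UNIV[OF up] zero_mem_up_closed[OF up]) auto
  moreover have "length fs \<le> CARD('n) - card A"
    if "set fs \<subseteq> graded_maximal_ideal" "regular_sequence_quot (exp_ideal U) fs"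
    for fs :: "('n, 'k) mpoly_ring list"
    using regular_sequence_length_le[OF up w A _ that(2)] graded_maximal_ideal_constant that(1) by blast
  ultimately show ?thesis unfolding depth_quot_def by (auto intro!: SUP_least)
qed


section \<open>Regular sequences\<close>

lemma regular_sequence_append:
  assumes "regular_sequence_quot J xs" "regular_sequence_quot (J \<union> set xs) ys"
  shows "regular_sequence_quot J (xs @ ys)"
  unfolding regular_sequence_quot_def
proof safe
  fix i g assume i: "i < length (xs @ ys)"
    and g: "(xs @ ys) ! i * g \<in> ideal.span (J \<union> set (take i (xs @ ys)))"
  show "g \<in> ideal.span (J \<union> set (take i (xs @ ys)))"
  proof (cases "i < length xs")
    case True
    with g assms(1) show ?thesis by (simp add: regular_sequence_quot_def nth_append)
  next
    case False
    then obtain j where "i = length xs + j" using le_Suc_ex not_less by blast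
    with i g assms(2) show ?thesis
      by (simp add: regular_sequence_quot_def Un_assoc)
  qed
next
  assume "ideal.span (J \<union> set (xs @ ys)) = UNIV"
  with assms(2) show False by (simp add: regular_sequence_quot_def Un_assoc)
qed

lemma depth_quot_ge:
  assumes "set fs \<subseteq> graded_maximal_ideal" "regular_sequence_quot J fs"
  shows "enat (length fs) \<le> depth_quot J"
  unfolding depth_quot_def using assms by (auto intro!: SUP_upper)

lemma lookup_var_mult: "lookup (var i * p) (single i 1 + a) = lookup p a"
  using lookup_single_mult[of "single i 1" 1 p a] by (simp add: var_def monomial_def)

lemma lookup_var_mult_0: "\<nexists>b. a = single i 1 + b \<Longrightarrow> lookup (var i * p) a = 0"
  using lookup_single_mult_0[of a "single i 1" 1 p] by (simp add: var_def monomial_def)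

text \<open>The hypothesis \<open>free\<close> says that no minimal generator involves the variables
  in \<open>bs\<close>, and setting some of them to 0 does not affect the exponents of the
  others.\<close>

lemma regular_sequence_vars:
  assumes up: "up_closed U" and "0 \<notin> U" and bs: "distinct bs"
    and free: "\<And>a b. b \<in> set bs \<Longrightarrow> single b 1 + a \<in> U \<Longrightarrow> a \<in> U"
  shows "regular_sequence_quot (exp_ideal U :: ('n::finite, 'k::field) mpoly_ring set) (map var bs)"
proof -
  let ?V = "\<lambda>B. U \<union> {a. \<exists>b\<in>B. lookup a b > 0}"
  have span: "ideal.span (exp_ideal U \<union> var ` B) = (exp_ideal (?V B) :: ('n, 'k) mpoly_ring set)" for B
    by (rule span_exp_ideal_vars[OF up])
  have "g \<in> exp_ideal (?V (set (take i bs)))"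
    if i: "i < length bs" and g: "var (bs ! i) * g \<in> exp_ideal (?V (set (take i bs)))"
    for i and g :: "('n, 'k) mpoly_ring"
    unfolding exp_ideal_def
  proof (intro CollectI subsetI UnCI)
    fix a assume a: "a \<in> keys g" "a \<notin> {a. \<exists>b\<in>set (take i bs). lookup a b > 0}"
    have ni: "bs ! i \<notin> set (take i bs)"
      using bs i by (auto simp: distinct_conv_nth in_set_conv_nth)
    have "single (bs ! i) 1 + a \<in> keys (var (bs ! i) * g)"
      using a(1) by (simp only: in_keys_iff lookup_var_mult) simp
    with g have "single (bs ! i) 1 + a \<in> ?V (set (take i bs))" by (auto simp: exp_ideal_def)
    moreover have "lookup (single (bs ! i) 1 + a) b = lookup a b" if "b \<in> set (take i bs)" for b
      using that ni by (auto simp: lookup_add lookup_single when_def)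
    ultimately have "single (bs ! i) 1 + a \<in> U" using a(2) by fastforce
    then show "a \<in> U" by (rule free[rotated]) (use i in simp)
  qed
  moreover have "exp_ideal (?V (set bs)) \<noteq> (UNIV :: ('n, 'k) mpoly_ring set)"
    using \<open>0 \<notin> U\<close> by (subst exp_ideal_eq_UNIV[OF up_closed_Un_var[OF up]]) simp
  ultimately show ?thesis
    unfolding regular_sequence_quot_def by (simp add: take_map span)
qed

section \<open>Differences of two variables\<close>

definition same_line :: "'n \<Rightarrow> 'n \<Rightarrow> ('n \<Rightarrow>\<^sub>0 nat) \<Rightarrow> ('n \<Rightarrow>\<^sub>0 nat) \<Rightarrow> bool" where
  "same_line y z a b \<longleftrightarrow> (\<forall>i. i \<noteq> y \<longrightarrow> i \<noteq> z \<longrightarrow> lookup a i = lookup b i) \<and>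
     lookup a y + lookup a z = lookup b y + lookup b z"

lemma same_line_swap: "same_line z y a b \<longleftrightarrow> same_line y z a b"
  by (auto simp: same_line_def)

text \<open>The only term that can cancel \<open>x_y * x^a\<close> comes from the neighbour of
  \<open>a\<close> in direction \<open>e_y - e_z\<close>. By extremality a neighbour in the support
  of \<open>g\<close> lies in \<open>V\<close>, and then so does \<open>single y 1 + a\<close>;
  without one there is no cancellation.\<close>

lemma var_diff_extremal:
  fixes g :: "('n::finite, 'k::field) mpoly_ring"
  assumes "y \<noteq> z" and up: "up_closed V"
    and g: "(var y - var z) * g \<in> exp_ideal V"
    and a: "a \<in> keys g"
    and max: "\<And>b. b \<in> keys g \<Longrightarrow> b \<notin> V \<Longrightarrow> same_line y z b a \<Longrightarrow> lookup b y \<le> lookup a y"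
  shows "single y 1 + a \<in> V"
proof (rule ccontr)
  assume nV: "single y 1 + a \<notin> V"
  with g have "lookup ((var y - var z) * g) (single y 1 + a) = 0"
    by (auto simp: exp_ideal_def in_keys_iff)
  then have "lookup (var y * g) (single y 1 + a) = lookup (var z * g) (single y 1 + a)"
    by (simp add: left_diff_distrib lookup_minus)
  with a have nz: "lookup (var z * g) (single y 1 + a) \<noteq> 0"
    unfolding lookup_var_mult by (simp add: in_keys_iff)
  then obtain b where b: "single y 1 + a = single z 1 + b" using lookup_var_mult_0 by blast
  have b': "lookup (single y 1) i + lookup a i = lookup (single z 1) i + lookup b i" for i
    using arg_cong[OF b, of "\<lambda>x. lookup x i"] by (simp add: lookup_add)
  have "b \<in> keys g" using nz unfolding b lookup_var_mult by (simp add: in_keys_iff)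
  moreover have "b \<notin> V"
    using nV up_closedD[OF up, of b "single z 1"] unfolding b by (auto simp: add.commute)
  moreover have "lookup b i = lookup a i" if "i \<noteq> y" "i \<noteq> z" for i
    using b'[of i] that by (simp add: lookup_single when_def)
  moreover have "lookup b y = Suc (lookup a y)" "lookup a z = Suc (lookup b z)"
    using b'[of y] b'[of z] \<open>y \<noteq> z\<close> by (simp_all add: lookup_single when_def)
  ultimately show False using max[of b] by (simp add: same_line_def)
qed

text \<open>If \<open>(x\<^sub>y - x\<^sub>z) g\<close> lies in a monomial ideal and \<open>g\<close> does not, then the two extremal exponents of
  \<open>g\<close> outside of the ideal on a line in direction \<open>e\<^sub>y - e\<^sub>z\<close> violate the assumption.\<close>

lemma var_diff_regular:
  fixes g :: "('n::finite, 'k::field) mpoly_ring"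
  assumes yz: "y \<noteq> z" and up: "up_closed V"
    and V: "\<And>a a' s. a \<notin> V \<Longrightarrow> a' \<notin> V \<Longrightarrow> single y 1 + a \<in> V \<Longrightarrow> single z 1 + a' \<in> V
      \<Longrightarrow> a + single z s = a' + single y s \<Longrightarrow> False"
    and g: "(var y - var z) * g \<in> exp_ideal V"
  shows "g \<in> exp_ideal V"
proof (rule ccontr)
  assume "g \<notin> exp_ideal V"
  then obtain a0 where a0: "a0 \<in> keys g" "a0 \<notin> V" by (auto simp: exp_ideal_def)
  define X where "X = {a \<in> keys g. a \<notin> V \<and> same_line y z a a0}"
  have X_ne: "a0 \<in> X" using a0 by (simp add: X_def same_line_def)
  have X_fin: "finite X" unfolding X_def by simp
  have X_line: "b \<in> X" if "b \<in> keys g" "b \<notin> V" "same_line y z b a" "a \<in> X" for a b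
    using that by (simp add: X_def same_line_def)
  have line: "same_line y z a b" if "a \<in> X" "b \<in> X" for a b
    using that by (simp add: X_def same_line_def)
  have "Max ((\<lambda>a. lookup a y) ` X) \<in> (\<lambda>a. lookup a y) ` X" using X_ne X_fin by (intro Max_in) auto
  then obtain a where a: "a \<in> X" "lookup a y = Max ((\<lambda>a. lookup a y) ` X)" by auto
  have a_max: "lookup b y \<le> lookup a y" if "b \<in> X" for b
    using that X_fin by (simp add: a(2))
  have "Max ((\<lambda>a. lookup a z) ` X) \<in> (\<lambda>a. lookup a z) ` X" using X_ne X_fin by (intro Max_in) auto
  then obtain a' where a': "a' \<in> X" "lookup a' z = Max ((\<lambda>a. lookup a z) ` X)" by auto
  have a'_max: "lookup b z \<le> lookup a' z" if "b \<in> X" for b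
    using that X_fin by (simp add: a'(2))
  have 1: "single y 1 + a \<in> V"
    by (rule var_diff_extremal[OF yz up g]) (use a(1) a_max X_line[of _ a] in \<open>auto simp: X_def\<close>)
  have "- ((var y - var z) * g) \<in> exp_ideal V"
    using g by (simp add: exp_ideal_def)
  then have g': "(var z - var y) * g \<in> exp_ideal V" by (simp add: algebra_simps)
  have 2: "single z 1 + a' \<in> V"
    by (rule var_diff_extremal[OF yz[symmetric] up g'])
      (use a'(1) a'_max X_line[of _ a'] in \<open>auto simp: X_def same_line_swap\<close>)
  \<comment> \<open>The shift is the distance of the two extremal points in the
    \<open>y\<close>-entry; the truncated subtraction is exact by the choice of
    \<open>a\<close>.\<close>
  have "a + single z (lookup a y - lookup a' y) = a' + single y (lookup a y - lookup a' y)"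
  proof (rule poly_mapping_eqI)
    fix i
    show "lookup (a + single z (lookup a y - lookup a' y)) i
        = lookup (a' + single y (lookup a y - lookup a' y)) i"
      using line[OF a(1) a'(1)] a_max[OF a'(1)] yz
      by (cases "i = y"; cases "i = z") (auto simp: same_line_def lookup_add lookup_single when_def)
  qed
  with 1 2 a(1) a'(1) show False using V[of a a'] by (auto simp: X_def)
qed

text \<open>The empty exponent set encodes the zero ideal, for which the condition of
  \<open>var_diff_regular\<close> is vacuous.\<close>

lemma var_diff_mult_eq_0:
  fixes g :: "('n::finite, 'k::field) mpoly_ring"
  assumes "y \<noteq> z" "(var y - var z) * g = 0"
  shows "g = 0"
  using var_diff_regular[of y z "{}" g] assms by (simp add: up_closed_def exp_ideal_empty)

section \<open>Principal monomial ideals\<close>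

definition rename :: "('n::finite \<Rightarrow> 'n) \<Rightarrow> ('n \<Rightarrow>\<^sub>0 nat) \<Rightarrow> ('n \<Rightarrow>\<^sub>0 nat)" where
  "rename \<sigma> a = (\<Sum>j\<in>UNIV. single (\<sigma> j) (lookup a j))"

lemma rename_add: "rename \<sigma> (a + b) = rename \<sigma> a + rename \<sigma> b"
  by (simp add: rename_def lookup_add single_add sum.distrib)

lemma rename_single: "rename \<sigma> (single i n) = single (\<sigma> i) n"
proof -
  have "rename \<sigma> (single i n) = (\<Sum>j\<in>UNIV. if j = i then single (\<sigma> j) n else 0)"
    unfolding rename_def by (rule sum.cong) (auto simp: lookup_single when_def)
  then show ?thesis by simp
qed

definition subst :: "('n \<Rightarrow> 'n) \<Rightarrow> ('n::finite, 'k::field) mpoly_ring \<Rightarrow> ('n, 'k) mpoly_ring" where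
  "subst \<sigma> p = (\<Sum>a\<in>keys p. single (rename \<sigma> a) (lookup p a))"

lemma subst_superset:
  assumes "finite X" "keys p \<subseteq> X"
  shows "subst \<sigma> p = (\<Sum>a\<in>X. single (rename \<sigma> a) (lookup p a))"
  unfolding subst_def by (rule sum.mono_neutral_left) (use assms in \<open>auto simp: in_keys_iff\<close>)

lemma subst_add: "subst \<sigma> (p + q) = subst \<sigma> p + subst \<sigma> q"
proof -
  let ?X = "keys p \<union> keys q"
  have "subst \<sigma> r = (\<Sum>a\<in>?X. single (rename \<sigma> a) (lookup r a))" if "keys r \<subseteq> ?X" for r
    using that by (intro subst_superset) auto
  from this[of p] this[of q] this[of "p + q"] show ?thesis
    using keys_add[of p q] by (simp add: lookup_add single_add sum.distrib)
qed

lemma subst_single: "subst \<sigma> (single a c) = single (rename \<sigma> a) c"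
  using subst_superset[of "{a}" "single a c"] by (simp split: if_splits)

lemma subst_0: "subst \<sigma> 0 = 0"
  by (simp add: subst_def)

lemma subst_sum: "subst \<sigma> (sum f X) = (\<Sum>x\<in>X. subst \<sigma> (f x))"
  by (induction X rule: infinite_finite_induct) (simp_all add: subst_0 subst_add)

lemma subst_mult: "subst \<sigma> (p * q) = subst \<sigma> p * subst \<sigma> q"
proof -
  have "p * q = (\<Sum>a\<in>keys p. \<Sum>b\<in>keys q. single a (lookup p a) * single b (lookup q b))"
    by (simp only: sum_product[symmetric] sum_single_lookup)
  then have "subst \<sigma> (p * q) = (\<Sum>a\<in>keys p. \<Sum>b\<in>keys q.
      single (rename \<sigma> a) (lookup p a) * single (rename \<sigma> b) (lookup q b))"
    by (simp add: subst_sum mult_single subst_single rename_add)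
  then show ?thesis by (simp only: subst_def sum_product)
qed

lemma subst_diff: "subst \<sigma> (p - q) = subst \<sigma> p - subst \<sigma> q"
  using subst_add[of \<sigma> "p - q" q] by (simp add: algebra_simps)

lemma subst_var: "subst \<sigma> (var i) = var (\<sigma> i)"
  by (simp add: var_def monomial_def subst_single rename_single)

lemma exponent_induct [case_names zero add_single]:
  fixes a :: "'n::finite \<Rightarrow>\<^sub>0 nat"
  assumes "P 0" "\<And>a i. P a \<Longrightarrow> P (single i 1 + a)"
  shows "P a"
proof (induction "\<Sum>i\<in>UNIV. lookup a i" arbitrary: a)
  case 0
  then have "a = 0" by (intro poly_mapping_eqI) simp
  with assms(1) show ?case by simp
next
  case (Suc n)
  then obtain i where i: "lookup a i > 0" by (metis gr0I nat.distinct(1) sum.neutral)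
  have a: "single i 1 + (a - single i 1) = a"
    by (rule exponent_add_diff) (use i in \<open>auto simp: lookup_single when_def\<close>)
  have "lookup a j = lookup (single i 1) j + lookup (a - single i 1) j" for j
    using arg_cong[OF a, of "\<lambda>x. lookup x j"] by (simp add: lookup_add)
  then have "(\<Sum>j\<in>UNIV. lookup a j) = (\<Sum>j\<in>UNIV. lookup (single i 1) j) + (\<Sum>j\<in>UNIV. lookup (a - single i 1) j)"
    by (simp add: sum.distrib)
  also have "(\<Sum>j\<in>UNIV. lookup (single i 1) j) = (1 :: nat)" by (simp add: lookup_single when_def)
  finally have "P (a - single i 1)" using Suc by simp
  then show ?case using assms(2)[of "a - single i 1" i] a by simp
qed

text \<open>For monomials by telescoping:
  \<open>x_i m - x_j m' = x_i (m - m') + m' (x_i - x_j)\<close>, where \<open>j = \<sigma> i\<close>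
  and \<open>m'\<close> is the image of \<open>m\<close>.\<close>

lemma diff_subst_mem_span:
  fixes p :: "('n::finite, 'k::field) mpoly_ring"
  shows "p - subst \<sigma> p \<in> ideal.span ((\<lambda>j. var j - var (\<sigma> j)) ` UNIV)" (is "_ \<in> ?L")
proof -
  have 1: "single a 1 - single (rename \<sigma> a) 1 \<in> ?L" for a
  proof (induction a rule: exponent_induct)
    case zero
    then show ?case by (simp add: rename_def ideal.span_zero)
  next
    case (add_single a i)
    let ?v = "single (single i 1) 1 :: ('n, 'k) mpoly_ring" and ?w = "single (single (\<sigma> i) 1) 1 :: ('n, 'k) mpoly_ring"
    have "?v - ?w \<in> ?L"
      by (rule ideal.span_base) (auto simp: var_def monomial_def)
    then have "single (rename \<sigma> a) 1 * (?v - ?w) \<in> ?L" by (rule ideal.span_scale)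
    moreover have "?v * (single a 1 - single (rename \<sigma> a) 1) \<in> ?L"
      by (rule ideal.span_scale[OF add_single])
    ultimately have "?v * (single a 1 - single (rename \<sigma> a) 1) + single (rename \<sigma> a) 1 * (?v - ?w) \<in> ?L"
      by (intro ideal.span_add)
    then show ?case
      by (simp add: algebra_simps mult_single rename_add rename_single)
  qed
  have "single a c - single (rename \<sigma> a) c \<in> ?L" for a c
    using ideal.span_scale[OF 1, of "single 0 c" a] by (simp add: algebra_simps mult_single)
  then have "(\<Sum>a\<in>keys p. single a (lookup p a) - single (rename \<sigma> a) (lookup p a)) \<in> ?L"
    by (intro ideal.span_sum) blast
  then show ?thesis by (simp add: sum_subtractf sum_single_lookup subst_def)
qed

lemma single_mult_eq_0:
  fixes p :: "('n \<Rightarrow>\<^sub>0 nat) \<Rightarrow>\<^sub>0 'k::comm_ring_1"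
  assumes "single u 1 * p = 0"
  shows "p = 0"
proof (rule poly_mapping_eqI)
  show "lookup p a = lookup 0 a" for a
    using lookup_single_mult[of u 1 p a] by (simp add: assms)
qed

definition multiples :: "('n \<Rightarrow>\<^sub>0 nat) \<Rightarrow> ('n \<Rightarrow>\<^sub>0 nat) set" where
  "multiples u = {a. \<forall>i. lookup u i \<le> lookup a i}"

lemma multiples_eq: "multiples u = {u + b | b. True}"
proof safe
  fix a assume "a \<in> multiples u"
  then have "a = u + (a - u)" by (intro exponent_add_diff[symmetric]) (simp add: multiples_def)
  then show "\<exists>b. a = u + b \<and> True" by blast
qed (simp add: multiples_def lookup_add)

lemma exp_ideal_multiples:
  "exp_ideal (multiples u) = (ideal.span {single u 1} :: ('n::finite, 'k::field) mpoly_ring set)"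
proof -
  have "ideal.span (monomial ` {u} :: ('n, 'k) mpoly_ring set) = exp_ideal {a + b | a b. a \<in> {u}}"
    by (rule span_monomials)
  then show ?thesis by (simp add: monomial_def multiples_eq)
qed

text \<open>Setting \<open>x\<^sub>k = x\<^sub>i\<close> for \<open>k \<in> T\<close> and then also \<open>x\<^sub>j = x\<^sub>i\<close> keeps the generator a monomial,
  so the cofactor \<open>h\<close> below vanishes after the second substitution.\<close>

lemma principal_var_diff_regular:
  fixes g :: "('n::finite, 'k::field) mpoly_ring"
  assumes ij: "i \<notin> T" "j \<notin> T" "j \<noteq> i"
    and g: "(var j - var i) * g \<in> ideal.span (insert (single u 1) ((\<lambda>k. var k - var i) ` T))"
      (is "_ \<in> ?L")
  shows "g \<in> ideal.span (insert (single u 1) ((\<lambda>k. var k - var i) ` T))"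
proof -
  define \<sigma> where "\<sigma> k = (if k \<in> T then i else k)" for k
  define \<tau> where "\<tau> k = (if k = j then i else k)" for k
  define v where "v = rename \<sigma> u"
  \<comment> \<open>\<open>\<sigma>\<close> annihilates the linear generators and maps the monomial
    generator to \<open>x^v\<close>.\<close>
  have mult: "\<exists>h. subst \<sigma> p = single v 1 * h" if "p \<in> ?L" for p
  proof -
    let ?S = "{p. \<exists>h. subst \<sigma> p = single v 1 * h}"
    have "ideal.subspace ?S"
    proof (rule ideal.subspaceI)
      show "0 \<in> ?S" by (auto simp: subst_0 intro!: exI[of _ 0])
      show "p + q \<in> ?S" if "p \<in> ?S" "q \<in> ?S" for p q
        using that by (auto simp: subst_add simp flip: distrib_left)
      show "c * p \<in> ?S" if "p \<in> ?S" for c p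
        using that by (auto simp: subst_mult mult.left_commute[of "subst \<sigma> c"])
    qed
    moreover have "insert (single u 1) ((\<lambda>k. var k - var i) ` T) \<subseteq> ?S"
      using ij by (auto simp: subst_single v_def subst_diff subst_var \<sigma>_def intro: exI[of _ 1] exI[of _ 0])
    ultimately show ?thesis using that ideal.span_minimal by blast
  qed
  have sub: "p - subst \<sigma> p \<in> ?L" for p
  proof -
    have "var k - var (\<sigma> k) \<in> ?L" for k
      by (cases "k \<in> T") (auto simp: \<sigma>_def ideal.span_zero intro: ideal.span_base)
    then have "ideal.span ((\<lambda>k. var k - var (\<sigma> k)) ` UNIV) \<subseteq> ?L"
      by (intro ideal.span_minimal) auto
    then show ?thesis using diff_subst_mem_span[of p \<sigma>] by blast
  qed
  obtain h where "subst \<sigma> ((var j - var i) * g) = single v 1 * h" using mult[OF g] by blast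
  then have h: "(var j - var i) * subst \<sigma> g = single v 1 * h"
    using ij by (simp add: subst_mult subst_diff subst_var \<sigma>_def)
  from arg_cong[OF this, of "subst \<tau>"] have "single (rename \<tau> v) 1 * subst \<tau> h = 0"
    using ij by (simp add: subst_mult subst_diff subst_var subst_single \<tau>_def)
  then have "subst \<tau> h = 0" by (rule single_mult_eq_0)
  \<comment> \<open>A polynomial vanishing under \<open>x_j = x_i\<close> is a multiple of
    \<open>x_j - x_i\<close>; cancelling this factor shows that \<open>x^v\<close> divides
    \<open>subst \<sigma> g\<close>.\<close>
  then have "h \<in> ideal.span ((\<lambda>k. var k - var (\<tau> k)) ` UNIV)"
    using diff_subst_mem_span[of h \<tau>] by simp
  moreover have "(\<lambda>k. var k - var (\<tau> k)) ` UNIV \<subseteq> ideal.span {var j - var i}"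
    by (auto simp: \<tau>_def ideal.span_zero intro: ideal.span_base)
  ultimately have "h \<in> ideal.span {var j - var i}"
    using ideal.span_minimal[OF _ ideal.subspace_span] by blast
  then obtain h' where "h = h' * (var j - var i)" by (auto simp: ideal.span_singleton)
  with h have "(var j - var i) * (subst \<sigma> g - single v 1 * h') = 0"
    by (simp add: algebra_simps)
  then have "subst \<sigma> g - single v 1 * h' = 0" using ij(3) by (rule var_diff_mult_eq_0[rotated])
  then have eq: "g = (g - subst \<sigma> g) + h' * single v 1" by (simp add: algebra_simps)
  have "single u 1 \<in> ?L" by (rule ideal.span_base) simp
  from ideal.span_diff[OF this sub[of "single u 1"]] have "single v 1 \<in> ?L"
    by (simp add: subst_single v_def)
  then have "(g - subst \<sigma> g) + h' * single v 1 \<in> ?L"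
    by (intro ideal.span_add ideal.span_scale sub)
  then show ?thesis by (simp only: eq[symmetric])
qed

lemma depth_quot_principal_ge:
  assumes "u \<noteq> 0"
  shows "enat (CARD('n) - 1) \<le> depth_quot (exp_ideal (multiples u) :: ('n::finite, 'k::field) mpoly_ring set)"
proof -
  obtain i :: 'n where True by simp
  obtain js where js: "set js = - {i}" "distinct js" using finite_distinct_list[of "- {i}"] by auto
  define fs where "fs = map (\<lambda>j. var j - var i :: ('n, 'k) mpoly_ring) js"
  have "length fs = card (- {i})" using distinct_card[OF js(2)] by (simp add: fs_def js(1))
  also have "\<dots> = CARD('n) - 1" by (simp add: Compl_eq_Diff_UNIV card_Diff_subset)
  finally have len: "length fs = CARD('n) - 1" .
  have fs: "set fs \<subseteq> graded_maximal_ideal"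
    unfolding fs_def using var_graded_maximal_ideal
    by (auto simp: graded_maximal_ideal_def intro!: ideal.span_diff)
  have span: "ideal.span (exp_ideal (multiples u) \<union> F) = ideal.span (insert (single u 1) F)"
    for F :: "('n, 'k) mpoly_ring set"
  proof -
    have "ideal.span (ideal.span {single u 1} \<union> F) = ideal.span (insert (single u 1) F)"
    proof (rule subset_antisym)
      show "ideal.span (ideal.span {single u 1} \<union> F) \<subseteq> ideal.span (insert (single u 1) F)"
        using ideal.span_mono[of "{single u 1}" "insert (single u 1) F"] ideal.span_superset[of "insert (single u 1) F"]
        by (intro ideal.span_minimal ideal.subspace_span) blast
      show "ideal.span (insert (single u 1) F) \<subseteq> ideal.span (ideal.span {single u 1} \<union> F)"
        by (intro ideal.span_mono) (auto intro: ideal.span_base)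
    qed
    then show ?thesis by (simp only: exp_ideal_multiples)
  qed
  have "regular_sequence_quot (exp_ideal (multiples u)) fs"
    unfolding regular_sequence_quot_def span
  proof (intro conjI allI impI)
    fix l g
    assume l: "l < length fs" and g: "fs ! l * g \<in> ideal.span (insert (single u 1) (set (take l fs)))"
    have set: "set (take l fs) = (\<lambda>j. var j - var i) ` set (take l js)"
      by (simp add: fs_def take_map)
    have "js ! l \<notin> set (take l js)"
      using js(2) l by (auto simp: fs_def distinct_conv_nth in_set_conv_nth)
    moreover have "js ! l \<in> set js" using l by (simp add: fs_def)
    moreover have "i \<notin> set (take l js)" using set_take_subset[of l js] js(1) by auto
    ultimately show "g \<in> ideal.span (insert (single u 1) (set (take l fs)))"
      using principal_var_diff_regular[of i "set (take l js)" "js ! l" g u] g l js(1)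
      by (simp add: set) (simp add: fs_def)
  next
    \<comment> \<open>All generators have constant coefficient 0, for \<open>x^u\<close> because
      \<open>u \<noteq> 0\<close>; hence the ideal is proper.\<close>
    have "ideal.span (insert (single u 1) (set fs)) \<subseteq> {p. lookup p 0 = 0}"
    proof (rule ideal.span_minimal[OF _ subspace_zero_constant])
      show "insert (single u 1) (set fs) \<subseteq> {p. lookup p 0 = 0}"
        using fs graded_maximal_ideal_constant assms by (auto simp: lookup_single when_def)
    qed
    moreover have "lookup (1 :: ('n, 'k) mpoly_ring) 0 \<noteq> 0" by simp
    ultimately show "ideal.span (insert (single u 1) (set fs)) \<noteq> UNIV" by blast
  qed
  from depth_quot_ge[OF fs this] show ?thesis by (simp only: len)
qed


section \<open>Depth at most \<open>n - 2\<close> for non-principal monomial ideals\<close>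

definition exponent :: "('n \<Rightarrow> nat) \<Rightarrow> ('n::finite \<Rightarrow>\<^sub>0 nat)" where
  "exponent f = (\<Sum>i\<in>UNIV. single i (f i))"

lemma lookup_exponent [simp]: "lookup (exponent f) j = f j"
proof -
  have "lookup (exponent f) j = (\<Sum>i\<in>UNIV. if i = j then f i else 0)"
    by (simp add: exponent_def lookup_sum lookup_single when_def)
  then show ?thesis by simp
qed

text \<open>\<open>B\<close> is a maximal set of variables that can be inverted without
  \<open>x^u\<close> entering the ideal. Multiplying \<open>x^u\<close> by a high power of the
  variables in \<open>B\<close> gives \<open>w\<close>; by maximality every other variable has a
  power moving \<open>w\<close> into the ideal.\<close>

lemma maximal_saturation:
  fixes U :: "('n::finite \<Rightarrow>\<^sub>0 nat) set"
  assumes up: "up_closed U" and u: "u \<notin> U"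
  shows "\<exists>B w. (\<forall>N. u + exponent (\<lambda>i. if i \<in> B then N else 0) \<notin> U) \<and> w \<notin> U \<and>
    (\<forall>i\<in>-B. \<exists>N. w + single i N \<in> U)"
proof -
  let ?e = "\<lambda>B N. exponent (\<lambda>i. if i \<in> B then N else 0)"
  let ?good = "{B. \<forall>N. u + ?e B N \<notin> U}"
  have "(?e {} N :: 'n \<Rightarrow>\<^sub>0 nat) = 0" for N by (rule poly_mapping_eqI) simp
  then have "{} \<in> ?good" using u by simp
  then have "?good \<noteq> {}" by blast
  from finite_has_maximal[OF _ this] obtain B
    where B: "B \<in> ?good" "\<And>B'. B' \<in> ?good \<Longrightarrow> B \<subseteq> B' \<Longrightarrow> B = B'"
    by auto
  have "\<forall>i\<in>-B. \<exists>N. u + ?e (insert i B) N \<in> U"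
  proof
    fix i assume "i \<in> -B"
    then have "insert i B \<notin> ?good" using B(2)[of "insert i B"] by blast
    then show "\<exists>N. u + ?e (insert i B) N \<in> U" by blast
  qed
  from bchoice[OF this] obtain M where M: "\<forall>i\<in>-B. u + ?e (insert i B) (M i) \<in> U" ..
  define N where "N = Max (insert 0 (M ` (-B)))"
  have "u + ?e B N + single i (M i) \<in> U" if "i \<in> -B" for i
  proof (rule up_closed_mono[OF up])
    show "u + ?e (insert i B) (M i) \<in> U" using M that by blast
    have "M i \<le> N" unfolding N_def using that by (intro Max_ge) auto
    then show "lookup (u + ?e (insert i B) (M i)) j \<le> lookup (u + ?e B N + single i (M i)) j" for j
      by (simp add: lookup_add lookup_single when_def)
  qed
  moreover have "u + ?e B N \<notin> U" using B(1) by blast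
  ultimately show ?thesis using B(1) by (intro exI[of _ B] exI[of _ "u + ?e B N"]) blast
qed

text \<open>Inverting the variables in \<open>B\<close> puts \<open>x^u\<close> into the ideal once
  some monomial of the ideal divides it away from \<open>B\<close>. This limits the sets
  \<open>B\<close> of \<open>maximal_saturation\<close>.\<close>

lemma mem_saturation:
  fixes U :: "('n::finite \<Rightarrow>\<^sub>0 nat) set"
  assumes up: "up_closed U" and v: "v \<in> U" "\<And>i. i \<notin> B \<Longrightarrow> lookup v i \<le> lookup u i"
  shows "\<exists>N. u + exponent (\<lambda>i. if i \<in> B then N else 0) \<in> U"
proof -
  define N where "N = Max (Set.range (lookup v))"
  have "lookup v i \<le> N" for i unfolding N_def by (intro Max_ge) auto
  then have "u + exponent (\<lambda>i. if i \<in> B then N else 0) \<in> U"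
    by (intro up_closed_mono[OF up v(1)]) (auto simp: lookup_add v(2) trans_le_add2)
  then show ?thesis ..
qed

text \<open>Saturate the monomial 1: since \<open>U\<close> is nonempty, not all variables can be
  inverted, so at least one remains outside of \<open>B\<close>.\<close>

lemma depth_quot_nonzero_le:
  assumes up: "up_closed U" and "U \<noteq> {}" "0 \<notin> U"
  shows "depth_quot (exp_ideal U :: ('n::finite, 'k::field) mpoly_ring set) \<le> enat (CARD('n) - 1)"
proof -
  from maximal_saturation[OF up \<open>0 \<notin> U\<close>] obtain B w
    where B: "\<And>N. 0 + exponent (\<lambda>i. if i \<in> B then N else 0) \<notin> U"
      and w: "w \<notin> U" "\<And>i. i \<in> -B \<Longrightarrow> \<exists>N. w + single i N \<in> U" by blast
  have "B \<noteq> UNIV"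
    using mem_saturation[OF up, of _ UNIV 0] B \<open>U \<noteq> {}\<close> by auto
  then have "-B \<noteq> {}" by blast
  then have "card (-B) \<ge> 1" by (simp add: Suc_le_eq card_gt_0_iff)
  then have "enat (CARD('n) - card (-B)) \<le> enat (CARD('n) - 1)" by simp
  with depth_quot_le[OF up w, where 'k = 'k] show ?thesis by (rule order_trans)
qed

text \<open>The exponent of the greatest common divisor of the monomials of the ideal; unspecified
  for empty \<open>U\<close>.\<close>

definition inf_exponent :: "('n::finite \<Rightarrow>\<^sub>0 nat) set \<Rightarrow> ('n \<Rightarrow>\<^sub>0 nat)" where
  "inf_exponent U = exponent (\<lambda>i. LEAST m. \<exists>a\<in>U. lookup a i = m)"

lemma inf_exponent_le: "a \<in> U \<Longrightarrow> lookup (inf_exponent U) i \<le> lookup a i"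
  unfolding inf_exponent_def lookup_exponent by (rule Least_le) blast

lemma inf_exponent_attained:
  assumes "U \<noteq> {}"
  shows "\<exists>a\<in>U. lookup a i = lookup (inf_exponent U) i"
proof -
  from assms obtain a where "a \<in> U" by blast
  then have "\<exists>b\<in>U. lookup b i = lookup a i" by blast
  then show ?thesis unfolding inf_exponent_def lookup_exponent by (rule LeastI)
qed

lemma inf_exponent_mem:
  assumes "up_closed U" "inf_exponent U \<in> U"
  shows "U = multiples (inf_exponent U)"
  using up_closed_mono[OF assms] inf_exponent_le[of _ U] by (auto simp: multiples_def)

text \<open>Saturate the greatest common divisor, which lies outside of a non-principal ideal. A
  single remaining variable \<open>x_i\<close> is impossible: some monomial of the ideal has the
  same exponent of \<open>x_i\<close> as the divisor, so inverting all other variables puts the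
  divisor into the ideal.\<close>

lemma depth_quot_nonprincipal_le:
  assumes up: "up_closed U" and "U \<noteq> {}" "\<And>u. U \<noteq> multiples u"
  shows "depth_quot (exp_ideal U :: ('n::finite, 'k::field) mpoly_ring set) \<le> enat (CARD('n) - 2)"
proof -
  let ?u = "inf_exponent U"
  have "?u \<notin> U" using inf_exponent_mem[OF up] assms(3) by blast
  from maximal_saturation[OF up this] obtain B w
    where B: "\<And>N. ?u + exponent (\<lambda>i. if i \<in> B then N else 0) \<notin> U"
      and w: "w \<notin> U" "\<And>i. i \<in> -B \<Longrightarrow> \<exists>N. w + single i N \<in> U" by blast
  have "card (-B) \<noteq> 0"
    using mem_saturation[OF up, of _ B ?u] B \<open>U \<noteq> {}\<close> by auto
  moreover have "card (-B) \<noteq> 1"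
  proof
    assume "card (-B) = 1"
    then obtain i where i: "-B = {i}" by (auto simp: card_1_singleton_iff)
    obtain v where "v \<in> U" "lookup v i = lookup ?u i"
      using inf_exponent_attained[OF \<open>U \<noteq> {}\<close>] by blast
    moreover have "j = i" if "j \<notin> B" for j using i that by blast
    ultimately have "lookup v j \<le> lookup ?u j" if "j \<notin> B" for j using that by fastforce
    then show False using mem_saturation[OF up \<open>v \<in> U\<close>, of B ?u] B by blast
  qed
  ultimately have "2 \<le> card (-B)" by linarith
  then have "enat (CARD('n) - card (-B)) \<le> enat (CARD('n) - 2)" by simp
  with depth_quot_le[OF up w, where 'k = 'k] show ?thesis by (rule order_trans)
qed

section \<open>Powers and roots of principal monomial ideals\<close>

lemma exp_power_nonempty: "U \<noteq> {} \<Longrightarrow> exp_power U k \<noteq> {}"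
  by (induction k) auto

lemma exp_power_multiples:
  fixes u :: "'n \<Rightarrow>\<^sub>0 nat"
  shows "\<exists>v. exp_power (multiples u) k = multiples v"
proof (induction k)
  case 0
  have "multiples (0 :: 'n \<Rightarrow>\<^sub>0 nat) = UNIV" by (simp add: multiples_def)
  then show ?case by (intro exI[of _ 0]) simp
next
  case (Suc k)
  then obtain v where v: "exp_power (multiples u) k = multiples v" ..
  have "{a + b | a b. a \<in> multiples u \<and> b \<in> multiples v} = multiples (u + v)"
  proof safe
    fix a b assume "a \<in> multiples u" "b \<in> multiples v"
    then show "a + b \<in> multiples (u + v)" by (simp add: multiples_def lookup_add add_mono)
  next
    fix c assume "c \<in> multiples (u + v)"
    then obtain b where "c = (u + b) + v"
      by (auto simp: multiples_eq add.assoc add.commute[of v] )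
    then show "\<exists>a b. c = a + b \<and> a \<in> multiples u \<and> b \<in> multiples v"
      by (intro exI[of _ "u + b"] exI[of _ v]) (simp add: multiples_def lookup_add)
  qed
  then show ?case using v by auto
qed

lemma exp_power_inf_exponent_le:
  "a \<in> exp_power U k \<Longrightarrow> k * lookup (inf_exponent U) i \<le> lookup a i"
  by (induction k arbitrary: a) (auto simp: lookup_add intro!: add_mono inf_exponent_le)

lemma exp_power_inf_exponent_attained:
  assumes "U \<noteq> {}"
  shows "\<exists>a\<in>exp_power U k. lookup a i = k * lookup (inf_exponent U) i"
proof (induction k)
  case 0
  then show ?case by (intro bexI[of _ 0]) simp_all
next
  case (Suc k)
  then obtain b where "b \<in> exp_power U k" "lookup b i = k * lookup (inf_exponent U) i" by blast
  moreover obtain a where "a \<in> U" "lookup a i = lookup (inf_exponent U) i"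
    using inf_exponent_attained[OF assms] by blast
  ultimately show ?case by (intro bexI[of _ "a + b"]) (auto simp: lookup_add)
qed

text \<open>Taking powers multiplies the exponent of the greatest common divisor by
  \<open>k\<close>, so the generator of a principal power is the \<open>k\<close>-th power of this
  divisor. Splitting off one factor from \<open>U\<close> then forces that factor to be the divisor
  itself.\<close>

lemma principal_root:
  assumes up: "up_closed U" and ne: "U \<noteq> {}" and k: "k \<ge> 1" and pow: "exp_power U k = multiples v"
  shows "U = multiples (inf_exponent U)"
proof -
  let ?u = "inf_exponent U"
  have v: "v \<in> exp_power U k" by (simp add: pow multiples_def)
  have v_le: "lookup v i \<le> k * lookup ?u i" for i
  proof -
    obtain a where "a \<in> multiples v" "lookup a i = k * lookup ?u i"
      using exp_power_inf_exponent_attained[OF ne, of k i] unfolding pow by blast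
    then show ?thesis by (auto simp: multiples_def dest: spec[of _ i])
  qed
  obtain l where l: "k = Suc l" using k by (cases k) auto
  with v obtain a b where ab: "v = a + b" "a \<in> U" "b \<in> exp_power U l" by auto
  have "lookup a i = lookup ?u i" for i
    using v_le[of i] exp_power_inf_exponent_le[OF ab(3), of i] inf_exponent_le[OF ab(2), of i]
    by (simp add: ab(1) l lookup_add)
  then have "a = ?u" by (rule poly_mapping_eqI)
  with ab(2) inf_exponent_mem[OF up] show ?thesis by simp
qed

section \<open>Limit depth and depth stability number\<close>

lemma depth_function_exp_ideal:
  "up_closed U \<Longrightarrow> depth_function (exp_ideal U :: ('n::finite, 'k::field) mpoly_ring set) k
    = depth_quot (exp_ideal (exp_power U k) :: ('n, 'k) mpoly_ring set)"
  by (simp add: depth_function_def ideal_power_exp_ideal)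

text \<open>A different value at \<open>r - 1\<close> excludes every candidate below
  \<open>r\<close>, since such a candidate would force equal values at \<open>r - 1\<close> and
  \<open>r\<close>.\<close>

lemma limit_depth_dstab:
  assumes "r \<ge> 1" "\<And>k. k \<ge> r \<Longrightarrow> depth_function I k = d"
    and "r \<ge> 2 \<Longrightarrow> depth_function I (r - 1) \<noteq> d"
  shows "depth_function I \<longlonglongrightarrow> d" "dstab I = r"
proof -
  have "eventually (\<lambda>k. depth_function I k = d) sequentially"
    using assms(2) unfolding eventually_sequentially by blast
  then show "depth_function I \<longlonglongrightarrow> d" by (rule tendsto_eventually)
  show "dstab I = r"
    unfolding dstab_def
  proof (rule Least_equality)
    fix k0 assume k0: "1 \<le> k0 \<and> (\<forall>k\<ge>k0. depth_function I k = depth_function I k0)"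
    show "r \<le> k0"
    proof (rule ccontr)
      assume less: "\<not> r \<le> k0"
      then have "k0 \<le> r" "k0 \<le> r - 1" by linarith+
      then have "depth_function I r = depth_function I k0"
        "depth_function I (r - 1) = depth_function I k0" using k0 by blast+
      moreover have "depth_function I r = d" by (rule assms(2)) simp
      moreover have "r \<ge> 2" using less k0 by linarith
      ultimately show False using assms(3) by metis
    qed
  next
    have "depth_function I k = depth_function I r" if "k \<ge> r" for k
      using assms(2)[OF that] assms(2)[OF order_refl] by simp
    with assms(1) show "1 \<le> r \<and> (\<forall>k\<ge>r. depth_function I k = depth_function I r)" by blast
  qed
qed

text \<open>Finite values are isolated points of \<open>enat\<close>, so the depth function is
  eventually constant and the set under \<open>LEAST\<close> is nonempty.\<close>

lemma dstab_ge_1: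
  assumes "depth_function I \<longlonglongrightarrow> enat m"
  shows "dstab I \<ge> 1"
proof -
  have "eventually (\<lambda>k. depth_function I k \<in> {enat m}) sequentially"
    using assms by (rule topological_tendstoD) (simp_all add: open_enat)
  then obtain k0 where k0: "\<And>k. k \<ge> k0 \<Longrightarrow> depth_function I k = enat m"
    by (auto simp: eventually_sequentially)
  let ?P = "\<lambda>k0. k0 \<ge> 1 \<and> (\<forall>k\<ge>k0. depth_function I k = depth_function I k0)"
  have "?P (Suc k0)" using k0 by simp
  then have "?P (Least ?P)" by (rule LeastI)
  then show ?thesis unfolding dstab_def by (rule conjunct1)
qed

lemma limit_depth_dstab_restriction:
  fixes I :: "('n::finite, 'k::field) mpoly_ring set"
  assumes I: "monomial_ideal I" "I \<noteq> UNIV" "I \<noteq> {0}"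
    and lim: "depth_function I \<longlonglongrightarrow> d"
  shows "d \<le> enat (CARD('n) - 2) \<and> dstab I \<ge> 1 \<or> d = enat (CARD('n) - 1) \<and> dstab I = 1"
proof -
  obtain U where up: "up_closed U" and IU: "I = exp_ideal U"
    using I(1) monomial_ideal_exp_ideal by blast
  have U: "0 \<notin> U" "U \<noteq> {}"
    using I(2,3) exp_ideal_eq_UNIV[OF up, where 'k = 'k] exp_ideal_empty by (auto simp: IU)
  note up' = up_closed_exp_power[OF up]
  have depth: "depth_function I k = depth_quot (exp_ideal (exp_power U k) :: ('n, 'k) mpoly_ring set)" for k
    by (simp add: IU depth_function_exp_ideal[OF up])
  show ?thesis
  proof (cases "\<exists>u. U = multiples u")
    case True
    have "depth_function I k = enat (CARD('n) - 1)" if k: "k \<ge> 1" for k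
    proof (rule antisym)
      show "depth_function I k \<le> enat (CARD('n) - 1)"
        unfolding depth using exp_power_nonempty[OF U(2)] exp_power_proper[OF U(1) k]
        by (intro depth_quot_nonzero_le up')
      obtain v where v: "exp_power U k = multiples v" using True exp_power_multiples by blast
      moreover have "v \<noteq> 0" using exp_power_proper[OF U(1) k] by (auto simp: v multiples_def)
      ultimately show "enat (CARD('n) - 1) \<le> depth_function I k"
        unfolding depth using depth_quot_principal_ge by simp
    qed
    from limit_depth_dstab[of 1, OF _ this] have "depth_function I \<longlonglongrightarrow> enat (CARD('n) - 1)" "dstab I = 1"
      by auto
    then show ?thesis using LIMSEQ_unique[OF lim] by blast
  next
    case False
    have "depth_function I k \<le> enat (CARD('n) - 2)" if k: "k \<ge> 1" for k
      unfolding depth using exp_power_nonempty[OF U(2)] principal_root[OF up U(2) k] False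
      by (intro depth_quot_nonprincipal_le up') blast+
    then have d: "d \<le> enat (CARD('n) - 2)"
      by (intro LIMSEQ_le_const2[OF lim]) blast
    then obtain m where "d = enat m" by (cases d) auto
    with lim d show ?thesis using dstab_ge_1 by blast
  qed
qed


section \<open>Realizing prescribed limit depth and depth stability number\<close>

lemma depth_quot_free_ge:
  assumes "up_closed U" "0 \<notin> U"
    and free: "\<And>a b. b \<in> B \<Longrightarrow> single b 1 + a \<in> U \<Longrightarrow> a \<in> U"
  shows "enat (card B) \<le> depth_quot (exp_ideal U :: ('n::finite, 'k::field) mpoly_ring set)"
proof -
  obtain bs where bs: "set bs = B" "distinct bs" using finite_distinct_list[of B] by auto
  have "regular_sequence_quot (exp_ideal U :: ('n, 'k) mpoly_ring set) (map var bs)"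
    using assms(1,2) bs(2) by (rule regular_sequence_vars) (use free bs(1) in blast)
  then have "enat (length (map var bs :: ('n, 'k) mpoly_ring list)) \<le> depth_quot (exp_ideal U :: ('n, 'k) mpoly_ring set)"
    by (intro depth_quot_ge) (auto simp: var_graded_maximal_ideal)
  then show ?thesis using distinct_card[OF bs(2)] bs(1) by simp
qed

text \<open>The variables in \<open>B\<close> form a regular sequence, and \<open>w\<close> is
  annihilated by powers of all others, so both bounds meet. The stable depths of all the examples
  are computed this way.\<close>

lemma depth_quot_eq_card:
  assumes "up_closed U" "0 \<notin> U"
    and "\<And>a b. b \<in> B \<Longrightarrow> single b 1 + a \<in> U \<Longrightarrow> a \<in> U"
    and "w \<notin> U" "\<And>i. i \<notin> B \<Longrightarrow> \<exists>N. w + single i N \<in> U"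
  shows "depth_quot (exp_ideal U :: ('n::finite, 'k::field) mpoly_ring set) = enat (card B)"
proof (rule antisym)
  have "card (- B) = CARD('n) - card B" by (simp add: Compl_eq_Diff_UNIV card_Diff_subset)
  moreover have "card B \<le> CARD('n)" by (rule card_mono) auto
  ultimately have "CARD('n) - card (- B) = card B" by simp
  with depth_quot_le[OF assms(1,4), of "- B", where 'k = 'k] assms(5)
  show "depth_quot (exp_ideal U :: ('n, 'k) mpoly_ring set) \<le> enat (card B)" by simp
qed (rule depth_quot_free_ge[OF assms(1-3)])

section \<open>Degree in a subset of the variables\<close>

definition weight :: "'n set \<Rightarrow> ('n \<Rightarrow>\<^sub>0 nat) \<Rightarrow> nat" where
  "weight W a = (\<Sum>i\<in>W. lookup a i)"

lemma weight_add: "weight W (a + b) = weight W a + weight W b"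
  by (simp add: weight_def lookup_add sum.distrib)

lemma weight_single: "weight W (single i N) = (if i \<in> W then N else 0)" for W :: "'n::finite set"
  by (simp add: weight_def lookup_single when_def)

lemma weight_mono: "(\<And>i. lookup a i \<le> lookup b i) \<Longrightarrow> weight W a \<le> weight W b"
  by (simp add: weight_def sum_mono)

lemma weight_pos: "weight W a > 0 \<longleftrightarrow> (\<exists>i\<in>W. lookup a i > 0)" for W :: "'n::finite set"
proof -
  have "weight W a = 0 \<longleftrightarrow> (\<forall>i\<in>W. lookup a i = 0)" by (simp add: weight_def)
  then show ?thesis by (auto simp: neq0_conv[symmetric] simp del: neq0_conv)
qed

lemma weight_diff: "(\<And>i. lookup b i \<le> lookup a i) \<Longrightarrow> weight W (a - b) = weight W a - weight W b"
  using weight_add[of W b "a - b"] exponent_add_diff[of b a] by simp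

lemma weight_0: "weight W 0 = 0"
  by (simp add: weight_def)

subsection \<open>Ideals generated by variables\<close>

lemma exp_power_variables:
  fixes A :: "'n::finite set"
  shows "exp_power {a. weight A a \<ge> 1} k = {a. weight A a \<ge> k}"
proof (induction k)
  case (Suc k)
  show ?case
  proof (intro subset_antisym subsetI)
    fix a assume "a \<in> exp_power {a. weight A a \<ge> 1} (Suc k)"
    then obtain g b where "a = g + b" "weight A g \<ge> 1" "weight A b \<ge> k" using Suc by auto
    then show "a \<in> {a. weight A a \<ge> Suc k}" by (simp add: weight_add)
  next
    fix a assume a: "a \<in> {a. weight A a \<ge> Suc k}"
    then obtain i where i: "i \<in> A" "lookup a i > 0" using weight_pos[of A a] by auto
    have le: "lookup (single i 1) j \<le> lookup a j" for j using i by (auto simp: lookup_single when_def)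
    have "weight A (a - single i 1) = weight A a - 1"
      using weight_diff[OF le, of A] i by (simp add: weight_single)
    with a have "a - single i 1 \<in> exp_power {a. weight A a \<ge> 1} k" using Suc by auto
    then show "a \<in> exp_power {a. weight A a \<ge> 1} (Suc k)"
      using i le by (intro exp_power_Suc_diffI[of "single i 1"]) (simp_all add: weight_single)
  qed
qed simp

text \<open>Take the ideal generated by the variables outside of a set \<open>B\<close> with
  \<open>d\<close> elements. Its powers leave \<open>B\<close> free, and modulo the
  \<open>k\<close>-th power the monomial \<open>x_i0^(k-1)\<close> is annihilated by powers of the
  remaining variables.\<close>

lemma stability_one_exists:
  assumes d: "d \<le> CARD('n) - 1"
  shows "\<exists>J :: ('n::finite, 'k::field) mpoly_ring set.
    monomial_ideal J \<and> depth_function J \<longlonglongrightarrow> enat d \<and> dstab J = 1"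
proof -
  have "d \<le> card (UNIV :: 'n set)" using d by simp
  then obtain B :: "'n set" where B: "card B = d" using obtain_subset_with_card_n by blast
  have "card B < CARD('n)" using d B by (simp add: less_le_trans[of d "CARD('n)"] le_less_trans diff_less)
  then obtain i0 where i0: "i0 \<notin> B" by (metis UNIV_eq_I less_irrefl)
  let ?P = "\<lambda>k. {a. weight (-B) a \<ge> k}"
  have up: "up_closed (?P k)" for k
    by (rule up_closedI) (use weight_mono in \<open>force intro: order_trans\<close>)
  define J :: "('n, 'k) mpoly_ring set" where "J = exp_ideal (?P 1)"
  have "depth_function J k = enat d" if k: "k \<ge> 1" for k
    unfolding J_def depth_function_exp_ideal[OF up] exp_power_variables B[symmetric]
  proof (rule depth_quot_eq_card[OF up])
    show "0 \<notin> ?P k" using k by (simp add: weight_0)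
    show "a \<in> ?P k" if "b \<in> B" "single b 1 + a \<in> ?P k" for a b
      using that by (simp add: weight_add weight_single)
    show "single i0 (k - 1) \<notin> ?P k" using i0 k by (simp add: weight_single)
    show "\<exists>N. single i0 (k - 1) + single i N \<in> ?P k" if "i \<notin> B" for i
      using that by (intro exI[of _ k]) (simp add: weight_add weight_single)
  qed
  then have "depth_function J \<longlonglongrightarrow> enat d \<and> dstab J = 1"
    using limit_depth_dstab[of 1 J "enat d"] by simp
  moreover have "monomial_ideal J" using up monomial_ideal_exp_ideal J_def by blast
  ultimately show ?thesis by blast
qed

subsection \<open>Limit depth \<open>n - 2\<close>\<close>

text \<open>The ideal \<open>(x\<^sup>e\<^sup>+\<^sup>1, x\<^sup>e y, x y\<^sup>e, y\<^sup>e\<^sup>+\<^sup>1) + z (x, y)\<^sup>e\<^sup>+\<^sup>1\<close>. Its \<open>k\<close>-th power is \<open>(x, y)\<^bsup>k(e+1)\<^esup>\<close> once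
  the sums of \<open>k\<close> elements of \<open>{0, 1, e, e + 1}\<close> fill the interval \<open>[0, k(e+1)]\<close>, that is, for
  \<open>k \<ge> e - 1\<close>.\<close>

definition gap_set :: "nat \<Rightarrow> 'n \<Rightarrow> 'n \<Rightarrow> 'n \<Rightarrow> ('n \<Rightarrow>\<^sub>0 nat) set" where
  "gap_set e x y z = {a. lookup a x + lookup a y \<ge> Suc e \<and>
     (lookup a z \<ge> 1 \<or> lookup a x \<ge> Suc e \<or> lookup a x \<ge> e \<and> lookup a y \<ge> 1 \<or>
      lookup a x \<ge> 1 \<and> lookup a y \<ge> e \<or> lookup a y \<ge> Suc e)}"

lemma up_closed_gap_set: "up_closed (gap_set e x y z)"
proof (rule up_closedI)
  fix a b :: "'a \<Rightarrow>\<^sub>0 nat"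
  assume a: "a \<in> gap_set e x y z" and le: "\<And>i. lookup a i \<le> lookup b i"
  show "b \<in> gap_set e x y z"
    using a le[of x] le[of y] le[of z] unfolding gap_set_def mem_Collect_eq by linarith
qed

text \<open>Splits off the generator \<open>x^(e+1-g) y^g\<close>; \<open>rest\<close> quantifies
  over \<open>b\<close> because only the exponents of \<open>x\<close> and \<open>y\<close> are
  controlled.\<close>

lemma gap_set_power_step:
  fixes x y z :: "'n::finite"
  assumes xy: "x \<noteq> y" and g: "g \<in> {0, 1, e, Suc e}"
    and a: "g \<le> lookup a y" "Suc e \<le> lookup a x + g"
    and rest: "\<And>b. lookup b y = lookup a y - g \<Longrightarrow> lookup b x = lookup a x - (Suc e - g)
      \<Longrightarrow> b \<in> exp_power (gap_set e x y z) k"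
  shows "a \<in> exp_power (gap_set e x y z) (Suc k)"
proof -
  define h where "h = single x (Suc e - g) + single y g"
  have h: "lookup h x = Suc e - g" "lookup h y = g" "\<And>i. i \<noteq> x \<Longrightarrow> i \<noteq> y \<Longrightarrow> lookup h i = 0"
    using xy by (auto simp: h_def lookup_add lookup_single when_def)
  show ?thesis
  proof (rule exp_power_Suc_diffI[of h])
    show "h \<in> gap_set e x y z" using g h by (auto simp: gap_set_def)
    show "lookup h i \<le> lookup a i" for i
      using a h by (cases "i = x"; cases "i = y") auto
    show "a - h \<in> exp_power (gap_set e x y z) k"
      by (rule rest) (simp_all add: lookup_minus h)
  qed
qed

text \<open>Each of the \<open>k\<close> factors has \<open>y\<close>-exponent 0, 1,
  \<open>e\<close> or \<open>e + 1\<close>. So \<open>j\<close> of them can contribute a summand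
  \<open>e\<close> and \<open>t\<close> of them a summand 1, independently of each other because
  \<open>e + 1\<close> is allowed.\<close>

lemma gap_set_power_fill:
  fixes x y z :: "'n::finite"
  assumes xy: "x \<noteq> y" and "j \<le> k" "t \<le> k"
    and "j * e + t \<le> lookup a y" "Suc e * k \<le> lookup a x + (j * e + t)"
  shows "a \<in> exp_power (gap_set e x y z) k"
  using assms(2-)
proof (induction k arbitrary: j t a)
  case (Suc k)
  obtain j' where j': "j' \<le> k" "j = j' \<or> j = Suc j'" using Suc.prems(1) by (cases j) auto
  obtain t' where t': "t' \<le> k" "t = t' \<or> t = Suc t'" using Suc.prems(2) by (cases t) auto
  \<comment> \<open>The remaining factors account for at most \<open>k * e + k\<close> of the
    \<open>y\<close>-exponent, which leaves enough of \<open>x\<close> for the factor with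
    \<open>y\<close>-exponent \<open>g\<close>.\<close>
  have bound: "j' * e \<le> k * e" using j'(1) by simp
  define g where "g = (j - j') * e + (t - t')"
  have "g \<in> {0, 1, e, Suc e}" using j'(2) t'(2) by (auto simp: g_def)
  moreover have sum: "j * e + t = g + (j' * e + t')"
    using j'(2) t'(2) by (auto simp: g_def)
  then have "g + (j' * e + t') \<le> lookup a y" "Suc e + (k * e + k) \<le> lookup a x + (g + (j' * e + t'))"
    using Suc.prems(3,4) by (simp_all add: mult.commute[of e k])
  moreover from this have "Suc e \<le> lookup a x + g" using bound t'(1) by linarith
  moreover have "g \<le> Suc e" using calculation(1) by auto
  moreover have "Suc e * k = k * e + k" by simp
  ultimately show ?case
    by (intro gap_set_power_step[OF xy, of g] Suc.IH[of j' t'] j'(1) t'(1)) linarith+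
qed simp

text \<open>With enough \<open>z\<close> all factors can be taken from
  \<open>z (x, y)^(e+1)\<close>, and the exponent of \<open>x\<close> is spent greedily.\<close>

lemma gap_set_power_z:
  fixes x y z :: "'n::finite"
  assumes dist: "x \<noteq> y" "x \<noteq> z" "y \<noteq> z"
    and "k \<le> lookup a z" "Suc e * k \<le> lookup a x + lookup a y"
  shows "a \<in> exp_power (gap_set e x y z) k"
  using assms(4-)
proof (induction k arbitrary: a)
  case (Suc k)
  define p where "p = min (lookup a x) (Suc e)"
  define h where "h = single x p + single y (Suc e - p) + single z 1"
  have h: "lookup h x = p" "lookup h y = Suc e - p" "lookup h z = 1"
    "\<And>i. i \<noteq> x \<Longrightarrow> i \<noteq> y \<Longrightarrow> i \<noteq> z \<Longrightarrow> lookup h i = 0"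
    using dist by (auto simp: h_def lookup_add lookup_single when_def)
  have p: "p \<le> lookup a x" "Suc e - p \<le> lookup a y" "p \<le> Suc e"
    using Suc.prems(2) by (auto simp: p_def)
  show ?case
  proof (rule exp_power_Suc_diffI[of h])
    show "h \<in> gap_set e x y z" using h p by (auto simp: gap_set_def)
    show "lookup h i \<le> lookup a i" for i
      using p h Suc.prems(1) by (cases "i = x"; cases "i = y"; cases "i = z") auto
    show "a - h \<in> exp_power (gap_set e x y z) k"
      by (rule Suc.IH) (use Suc.prems p in \<open>auto simp: lookup_minus h\<close>)
  qed
qed simp

text \<open>In minimal degree without \<open>z\<close> every factor is one of the four generators in
  \<open>x\<close> and \<open>y\<close>: either all have \<open>y\<close>-exponent at most 1, with
  total at most \<open>k\<close>, or one of them has \<open>y\<close>-exponent at least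
  \<open>e\<close>.\<close>

lemma gap_set_power_subset:
  assumes "a \<in> exp_power (gap_set e x y z) k"
  shows "Suc e * k \<le> lookup a x + lookup a y \<and>
    (lookup a x + lookup a y = Suc e * k \<and> lookup a z = 0 \<longrightarrow> lookup a y \<le> k \<or> lookup a y \<ge> e)"
  using assms
proof (induction k arbitrary: a)
  case (Suc k)
  then obtain g b where gb: "a = g + b" "g \<in> gap_set e x y z" "b \<in> exp_power (gap_set e x y z) k" by auto
  have "Suc e * Suc k = Suc e + Suc e * k" by simp
  then show ?case
    using Suc.IH[OF gb(3)] gb(2) unfolding gb(1) lookup_add gap_set_def mem_Collect_eq by linarith
qed simp

lemma gap_set_power_eq:
  fixes x y z :: "'n::finite"
  assumes xy: "x \<noteq> y" and e: "e \<ge> 1" "e \<le> Suc k"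
  shows "exp_power (gap_set e x y z) k = {a. Suc e * k \<le> lookup a x + lookup a y}"
proof (intro subset_antisym subsetI)
  fix a assume "a \<in> {a. Suc e * k \<le> lookup a x + lookup a y}"
  then have a: "Suc e * k \<le> lookup a x + lookup a y" by simp
  \<comment> \<open>\<open>q\<close> is the \<open>y\<close>-degree assigned to the factors, split
    into \<open>j * e\<close> and a remainder. The remainder is at most \<open>k\<close>: it is
    below \<open>e \<le> k + 1\<close>, or \<open>j = k\<close> and
    \<open>q \<le> k * e + k\<close>.\<close>
  define q where "q = min (lookup a y) (Suc e * k)"
  define j where "j = min k (q div e)"
  have "j * e \<le> q div e * e" unfolding j_def by (rule mult_le_mono1) simp
  then have je: "j * e \<le> q" using div_times_less_eq_dividend[of q e] by linarith
  have "q - j * e \<le> k"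
  proof (cases "q div e \<le> k")
    case True
    then have "q - j * e = q mod e" by (simp add: j_def minus_div_mult_eq_mod)
    also have "\<dots> < e" using e by simp
    finally show ?thesis using e by simp
  next
    case False
    then have "j = k" by (simp add: j_def)
    moreover have "q \<le> Suc e * k" by (simp add: q_def)
    ultimately show ?thesis by (simp add: mult.commute)
  qed
  then show "a \<in> exp_power (gap_set e x y z) k"
    using je a by (intro gap_set_power_fill[OF xy, of j k "q - j * e"]) (auto simp: j_def q_def)
next
  fix a assume "a \<in> exp_power (gap_set e x y z) k"
  from gap_set_power_subset[OF this] show "a \<in> {a. Suc e * k \<le> lookup a x + lookup a y}" by simp
qed

lemma codimension_two_exists:
  assumes n: "CARD('n::finite) \<ge> 3" and r: "r \<ge> 2"
  shows "\<exists>J :: ('n, 'k::field) mpoly_ring set.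
    monomial_ideal J \<and> depth_function J \<longlonglongrightarrow> enat (CARD('n) - 2) \<and> dstab J = r"
proof -
  obtain S :: "'n set" where "card S = 3" using obtain_subset_with_card_n[OF n] by blast
  then obtain x y z :: 'n where dist: "x \<noteq> y" "x \<noteq> z" "y \<noteq> z" by (auto simp: card_3_iff)
  \<comment> \<open>With this value the condition \<open>e \<le> Suc k\<close> of
    \<open>gap_set_power_eq\<close> reads \<open>k \<ge> r\<close>.\<close>
  define e where "e = Suc r"
  define J :: "('n, 'k) mpoly_ring set" where "J = exp_ideal (gap_set e x y z)"
  note up = up_closed_gap_set[of e x y z]
  note up' = up_closed_exp_power[OF up]
  have "0 \<notin> gap_set e x y z" by (simp add: gap_set_def)
  note proper = exp_power_proper[OF this]
  have large: "depth_function J k = enat (CARD('n) - 2)" if k: "k \<ge> r" for k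
  proof -
    define N where "N = Suc e * k"
    have eq: "exp_power (gap_set e x y z) k = {a. N \<le> lookup a x + lookup a y}"
      unfolding N_def using dist(1) k by (intro gap_set_power_eq) (auto simp: e_def)
    have "N > 0" using k r by (simp add: N_def)
    have "depth_function J k = enat (card (- {x, y}))"
      unfolding J_def depth_function_exp_ideal[OF up]
    proof (rule depth_quot_eq_card[OF up'])
      show "0 \<notin> exp_power (gap_set e x y z) k" using k r by (intro proper) simp
      show "a \<in> exp_power (gap_set e x y z) k"
        if "b \<in> - {x, y}" "single b 1 + a \<in> exp_power (gap_set e x y z) k" for a b
        using that by (simp add: eq lookup_add lookup_single when_def)
      show "single x (N - 1) \<notin> exp_power (gap_set e x y z) k"
        using \<open>N > 0\<close> dist(1) by (simp add: eq lookup_single when_def)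
      show "\<exists>M. single x (N - 1) + single i M \<in> exp_power (gap_set e x y z) k"
        if "i \<notin> - {x, y}" for i
        using that dist(1) \<open>N > 0\<close>
        by (intro exI[of _ 1]) (auto simp: eq lookup_add lookup_single when_def)
    qed
    also have "card (- {x, y}) = CARD('n) - 2"
      using dist(1) by (simp add: Compl_eq_Diff_UNIV card_Diff_subset)
    finally show ?thesis .
  qed
  have small: "depth_function J (r - 1) \<noteq> enat (CARD('n) - 2)"
  proof -
    define k where "k = r - 1"
    have k: "k \<ge> 1" "e = k + 2" using r by (simp_all add: k_def e_def)
    \<comment> \<open>For \<open>k = r - 1\<close> the \<open>y\<close>-exponent
      \<open>k + 1\<close> lies strictly between \<open>k\<close> and \<open>e = k + 2\<close>, so
      \<open>w\<close> is a missing monomial of minimal degree. Powers of each of \<open>x\<close>,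
      \<open>y\<close>, \<open>z\<close> move it into the ideal, so the depth is at most
      \<open>n - 3\<close>.\<close>
    define w where "w = single x (Suc e * k - Suc k) + single y (Suc k)"
    have le: "Suc k \<le> Suc e * k" using k by (cases k) simp_all
    have w: "lookup w x = Suc e * k - Suc k" "lookup w y = Suc k" "lookup w z = 0"
      using dist by (simp_all add: w_def lookup_add lookup_single when_def del: mult_Suc)
    have "w \<notin> exp_power (gap_set e x y z) k"
      using gap_set_power_subset[of w e x y z k] le k by (auto simp: w simp del: mult_Suc)
    moreover have "\<exists>N. w + single i N \<in> exp_power (gap_set e x y z) k" if i: "i \<in> {x, y, z}" for i
    proof -
      consider "i = x" | "i = y" | "i = z" using i by blast
      then have "w + single i (Suc e * k) \<in> exp_power (gap_set e x y z) k"
      proof cases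
        case 1
        then show ?thesis
          by (intro gap_set_power_fill[OF dist(1), of 0 _ 0]) (simp_all add: lookup_add)
      next
        case 2
        then show ?thesis
          by (intro gap_set_power_fill[OF dist(1), of k _ k]) (simp_all add: lookup_add mult.commute)
      next
        case 3
        then show ?thesis
          using w le dist by (intro gap_set_power_z[OF dist]) (simp_all add: lookup_add lookup_single when_def del: mult_Suc)
      qed
      then show ?thesis ..
    qed
    ultimately have "depth_function J k \<le> enat (CARD('n) - card {x, y, z})"
      unfolding J_def depth_function_exp_ideal[OF up] by (intro depth_quot_le[OF up'])
    also have "card {x, y, z} = 3" using dist by simp
    finally show ?thesis using n by (auto simp: k_def)
  qed
  from large small have "depth_function J \<longlonglongrightarrow> enat (CARD('n) - 2) \<and> dstab J = r"
    using limit_depth_dstab[of r J "enat (CARD('n) - 2)"] r by simp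
  moreover have "monomial_ideal J" using up monomial_ideal_exp_ideal J_def by blast
  ultimately show ?thesis by blast
qed


subsection \<open>Limit depth at most \<open>n - 3\<close>\<close>

text \<open>The ideal \<open>(x\<^bsup>p+2\<^esup>, x y\<^sup>p z, y\<^bsup>p+1\<^esup> z) + (w | w \<in> W)\<close>. In \<open>in_tail_power\<close> the number \<open>K\<close> counts
  factors \<open>x\<^bsup>p+2\<^esup>\<close>, \<open>s\<close> counts factors \<open>x y\<^sup>p z\<close> and \<open>j - s\<close> counts factors \<open>y\<^bsup>p+1\<^esup> z\<close>.\<close>

definition tail_set :: "nat \<Rightarrow> 'n \<Rightarrow> 'n \<Rightarrow> 'n \<Rightarrow> 'n set \<Rightarrow> ('n \<Rightarrow>\<^sub>0 nat) set" where
  "tail_set p x y z W = {a. lookup a x \<ge> p + 2 \<or> weight W a \<ge> 1 \<or>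
     lookup a z \<ge> 1 \<and> (lookup a x \<ge> 1 \<and> lookup a y \<ge> p \<or> lookup a y \<ge> p + 1)}"

definition in_tail_power ::
    "nat \<Rightarrow> 'n \<Rightarrow> 'n \<Rightarrow> 'n \<Rightarrow> 'n set \<Rightarrow> nat \<Rightarrow> nat \<Rightarrow> nat \<Rightarrow> nat \<Rightarrow> ('n \<Rightarrow>\<^sub>0 nat) \<Rightarrow> bool" where
  "in_tail_power p x y z W k K j s a \<longleftrightarrow> k \<le> K + weight W a + j \<and> s \<le> j \<and> j \<le> lookup a z \<and>
     (p + 2) * K + s \<le> lookup a x \<and> (p + 1) * j \<le> lookup a y + s"

lemma up_closed_tail_set: "up_closed (tail_set p x y z W)"
proof (rule up_closedI)
  fix a b :: "'a \<Rightarrow>\<^sub>0 nat"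
  assume a: "a \<in> tail_set p x y z W" and le: "\<And>i. lookup a i \<le> lookup b i"
  show "b \<in> tail_set p x y z W"
    using a le[of x] le[of y] le[of z] weight_mono[OF le, of W]
    unfolding tail_set_def mem_Collect_eq by linarith
qed

lemma tail_set_power_add:
  assumes g: "g \<in> tail_set p x y z W" and b: "in_tail_power p x y z W k K j s b"
  shows "\<exists>K j s. in_tail_power p x y z W (Suc k) K j s (g + b)"
proof -
  note simps = in_tail_power_def lookup_add weight_add
  consider "lookup g x \<ge> p + 2" | "weight W g \<ge> 1" | "lookup g z \<ge> 1" "lookup g x \<ge> 1" "lookup g y \<ge> p"
    | "lookup g z \<ge> 1" "lookup g y \<ge> p + 1"
    using g unfolding tail_set_def by blast
  then show ?thesis
  proof cases
    case 1
    with b have "in_tail_power p x y z W (Suc k) (Suc K) j s (g + b)" by (simp add: simps)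
    then show ?thesis by blast
  next
    case 2
    with b have "in_tail_power p x y z W (Suc k) K j s (g + b)" by (simp add: simps)
    then show ?thesis by blast
  next
    case 3
    with b have "in_tail_power p x y z W (Suc k) K (Suc j) (Suc s) (g + b)" by (simp add: simps)
    then show ?thesis by blast
  next
    case 4
    with b have "in_tail_power p x y z W (Suc k) K (Suc j) s (g + b)" by (simp add: simps)
    then show ?thesis by blast
  qed
qed

text \<open>The counters tell which generator to remove: \<open>x y^p z\<close> if
  \<open>s > 0\<close>, otherwise \<open>y^(p+1) z\<close> if \<open>j > 0\<close>, then
  \<open>x^(p+2)\<close> if \<open>K > 0\<close>, and a variable from \<open>W\<close> if all of
  them vanish.\<close>

lemma tail_set_power_split:
  fixes x y z :: "'n::finite"
  assumes dist: "x \<noteq> y" "x \<noteq> z" "y \<noteq> z" "x \<notin> W" "y \<notin> W" "z \<notin> W"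
    and a: "in_tail_power p x y z W (Suc k) K j s a"
  shows "\<exists>g K j s. g \<in> tail_set p x y z W \<and> (\<forall>i. lookup g i \<le> lookup a i) \<and>
    in_tail_power p x y z W k K j s (a - g)"
proof -
  have split: ?thesis
    if le: "\<And>i. lookup g i \<le> lookup a i" and g: "g \<in> tail_set p x y z W"
      and *: "k \<le> K' + (weight W a - weight W g) + j'" "s' \<le> j'" "j' \<le> lookup a z - lookup g z"
      "(p + 2) * K' + s' \<le> lookup a x - lookup g x" "(p + 1) * j' \<le> lookup a y - lookup g y + s'"
    for g K' j' s'
  proof -
    have "in_tail_power p x y z W k K' j' s' (a - g)"
      using * weight_diff[OF le, of W] by (simp add: in_tail_power_def lookup_minus)
    with le g show ?thesis by blast
  qed
  note a = a[unfolded in_tail_power_def]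
  consider (xz) j' s' where "j = Suc j'" "s = Suc s'" | (yz) j' where "j = Suc j'" "s = 0"
    | (x) K' where "j = 0" "K = Suc K'" | (w) "j = 0" "K = 0"
    using a by (cases j; cases s; cases K) auto
  then show ?thesis
  proof cases
    case xz
    define g where "g = single x 1 + single y p + single z 1"
    have g: "lookup g x = 1" "lookup g y = p" "lookup g z = 1" "weight W g = 0"
      "\<And>i. i \<noteq> x \<Longrightarrow> i \<noteq> y \<Longrightarrow> i \<noteq> z \<Longrightarrow> lookup g i = 0"
      using dist by (simp_all add: g_def lookup_add lookup_single when_def weight_add weight_single)
    have "p * j' + p + j' \<le> lookup a y + s'" using a by (simp add: xz algebra_simps)
    with a xz have y: "p \<le> lookup a y" by simp
    show ?thesis
    proof (rule split[of g K j' s'])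
      show "lookup g i \<le> lookup a i" for i
        using a y g xz by (cases "i = x"; cases "i = y"; cases "i = z") auto
    qed (use a y in \<open>auto simp: g tail_set_def xz\<close>)
  next
    case yz
    define g where "g = single y (p + 1) + single z 1"
    have g: "lookup g x = 0" "lookup g y = p + 1" "lookup g z = 1" "weight W g = 0"
      "\<And>i. i \<noteq> x \<Longrightarrow> i \<noteq> y \<Longrightarrow> i \<noteq> z \<Longrightarrow> lookup g i = 0"
      using dist by (simp_all add: g_def lookup_add lookup_single when_def weight_add weight_single)
    have y: "p + 1 \<le> lookup a y" using a by (simp add: yz)
    show ?thesis
    proof (rule split[of g K j' 0])
      show "lookup g i \<le> lookup a i" for i
        using a y g yz by (cases "i = x"; cases "i = y"; cases "i = z") auto
    qed (use a y in \<open>auto simp: g tail_set_def yz\<close>)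
  next
    case x
    define g where "g = single x (p + 2)"
    have g: "lookup g x = p + 2" "weight W g = 0" "\<And>i. i \<noteq> x \<Longrightarrow> lookup g i = 0"
      using dist by (simp_all add: g_def lookup_add lookup_single when_def weight_single)
    show ?thesis
    proof (rule split[of g K' 0 0])
      show "lookup g i \<le> lookup a i" for i
        using a g x by (cases "i = x") auto
    qed (use a dist in \<open>auto simp: g tail_set_def x\<close>)
  next
    case w
    then obtain i where i: "i \<in> W" "lookup a i > 0" using a weight_pos[of W a] by auto
    show ?thesis
    proof (rule split[of "single i 1" 0 0 0])
      show "lookup (single i 1) l \<le> lookup a l" for l
        using i by (auto simp: lookup_single when_def)
    qed (use a i in \<open>auto simp: tail_set_def weight_single w\<close>)
  qed
qed

text \<open>One factor at a time is added or removed. Factors from \<open>W\<close> need no counter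
  because \<open>weight W a\<close> already counts those available.\<close>

lemma tail_set_power:
  fixes x y z :: "'n::finite"
  assumes dist: "x \<noteq> y" "x \<noteq> z" "y \<noteq> z" "x \<notin> W" "y \<notin> W" "z \<notin> W"
  shows "a \<in> exp_power (tail_set p x y z W) k \<longleftrightarrow> (\<exists>K j s. in_tail_power p x y z W k K j s a)"
proof (induction k arbitrary: a)
  case 0
  have "in_tail_power p x y z W 0 0 0 0 a" by (simp add: in_tail_power_def)
  then show ?case by auto
next
  case (Suc k)
  show ?case
  proof
    assume "a \<in> exp_power (tail_set p x y z W) (Suc k)"
    then show "\<exists>K j s. in_tail_power p x y z W (Suc k) K j s a"
      using Suc tail_set_power_add by fastforce
  next
    assume "\<exists>K j s. in_tail_power p x y z W (Suc k) K j s a"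
    then obtain g K j s where g: "g \<in> tail_set p x y z W" "\<And>i. lookup g i \<le> lookup a i"
      "in_tail_power p x y z W k K j s (a - g)"
      using tail_set_power_split[OF dist] by metis
    then show "a \<in> exp_power (tail_set p x y z W) (Suc k)"
      using Suc by (intro exp_power_Suc_diffI[of g]) blast+
  qed
qed

text \<open>Excludes the extremal exponents of \<open>var_diff_regular\<close> for
  \<open>k \<le> p + 1\<close>. The decomposition at \<open>a'\<close> needs the added
  \<open>z\<close>, so \<open>lookup a' z \<le> p\<close>, and the \<open>y\<close>-exponent is
  large enough for \<open>a\<close> to use a factor \<open>y^(p+1) z\<close> for each
  \<open>z\<close> it has.\<close>

lemma tail_power_diff_regular:
  assumes dist: "x \<noteq> y" "x \<noteq> z" "y \<noteq> z" "x \<notin> W" "y \<notin> W" "z \<notin> W"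
    and k: "k \<le> p + 1"
    and a: "in_tail_power p x y z W k K1 j1 s1 (single y 1 + a)"
    and a': "in_tail_power p x y z W k K2 j2 s2 (single z 1 + a')"
    and line: "a + single z t = a' + single y t"
    and nota': "\<And>K j s. \<not> in_tail_power p x y z W k K j s a'"
  shows "\<exists>K j s. in_tail_power p x y z W k K j s a"
proof -
  have lookups: "lookup a i + lookup (single z t) i = lookup a' i + lookup (single y t) i" for i
    using arg_cong[OF line, of "\<lambda>x. lookup x i"] by (simp add: lookup_add)
  have ay: "lookup a y = lookup a' y + t" and az: "lookup a' z = lookup a z + t"
    using lookups[of y] lookups[of z] dist by (simp_all add: lookup_single when_def)
  note simps = in_tail_power_def lookup_add weight_add
  have W: "weight W a = weight W a'"
    unfolding weight_def
  proof (rule sum.cong)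
    fix i assume "i \<in> W"
    then have "i \<noteq> y" "i \<noteq> z" using dist by blast+
    then show "lookup a i = lookup a' i" using lookups[of i] by (simp add: lookup_single when_def)
  qed simp
  have wt0: "weight W (single y (Suc 0)) = 0" "weight W (single z (Suc 0)) = 0"
    using dist by (auto simp: weight_def lookup_single when_def intro!: sum.neutral)
  have sl: "lookup (single y (Suc 0)) x = 0" "lookup (single y (Suc 0)) z = 0"
    "lookup (single z (Suc 0)) x = 0" "lookup (single z (Suc 0)) y = 0"
    using dist by (simp_all add: lookup_single when_def)
  have A: "k \<le> K1 + weight W a + j1" "j1 \<le> lookup a z" "(p + 2) * K1 + s1 \<le> lookup a x"
    using a by (simp_all add: simps wt0 sl)
  have A': "k \<le> K2 + weight W a' + j2" "s2 \<le> j2" "j2 \<le> Suc (lookup a' z)"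
    "(p + 2) * K2 + s2 \<le> lookup a' x" "(p + 1) * j2 \<le> lookup a' y + s2"
    using a' by (simp_all add: simps wt0 sl)
  have j2: "j2 = Suc (lookup a' z)"
  proof (rule ccontr)
    assume "j2 \<noteq> Suc (lookup a' z)"
    with A' have "in_tail_power p x y z W k K2 j2 s2 a'" by (simp add: simps)
    with nota' show False by blast
  qed
  define c where "c = lookup a z"
  have c: "lookup a' z = c + t" "j2 = Suc (c + t)" using az j2 by (simp_all add: c_def)
  \<comment> \<open>With a spare factor, one containing \<open>z\<close> could be dropped, and
    \<open>a'\<close> would belong to the power.\<close>
  have "K2 + weight W a' + j2 = k"
  proof (rule ccontr)
    assume "K2 + weight W a' + j2 \<noteq> k"
    then have "in_tail_power p x y z W k K2 (c + t) (min s2 (c + t)) a'"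
      using A' by (auto simp: simps c min_def)
    with nota' show False by blast
  qed
  then have ct: "c + t \<le> p" using k c(2) by simp
  have "p * j2 + j2 \<le> lookup a' y + s2" using A'(5) by simp
  then have "p * j2 \<le> lookup a' y" using A'(2) by linarith
  then have "p * c + p \<le> lookup a' y" by (simp add: c(2) algebra_simps)
  then have y: "p * c + c \<le> lookup a y" using ct ay by linarith
  \<comment> \<open>At most \<open>c\<close> factors of \<open>single y 1 + a\<close> contain
    \<open>z\<close>, so at least this many are \<open>x^(p+2)\<close>; hence the
    \<open>x\<close>-exponent of \<open>a\<close> suffices for them.\<close>
  have "k - weight W a - c \<le> K1" using A by (simp add: c_def)
  then have "(p + 2) * (k - weight W a - c) \<le> (p + 2) * K1" by (rule mult_le_mono2)
  with A(3) have "(p + 2) * (k - weight W a - c) \<le> lookup a x" by linarith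
  with y have "in_tail_power p x y z W k (k - weight W a - c) c 0 a"
    by (simp add: simps c_def)
  then show ?thesis by blast
qed

text \<open>The exponent of \<open>z\<close> allows at most \<open>p + 1\<close> factors with
  \<open>z\<close>, so \<open>l + 1\<close> factors \<open>x^(p+2)\<close> are needed; they use up
  \<open>x\<close> and force \<open>s = 0\<close>. Then \<open>(p+1)^2 \<le> (p+2) p\<close> would
  be required, which fails by 1. One more \<open>x\<close>, \<open>y\<close> or \<open>z\<close>
  repairs this, as does a power of a variable in \<open>W\<close>.\<close>

lemma tail_power_socle:
  fixes x y z :: "'n::finite"
  assumes dist: "x \<noteq> y" "x \<noteq> z" "y \<noteq> z" "x \<notin> W" "y \<notin> W" "z \<notin> W"
    and w: "lookup w x = (p + 2) * Suc l" "lookup w y = (p + 2) * p" "lookup w z = p + 1" "weight W w = 0"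
    and i: "i \<in> {x, y, z} \<union> W"
  shows "\<not> in_tail_power p x y z W (p + 2 + l) K j s w"
    and "\<exists>N K j s. in_tail_power p x y z W (p + 2 + l) K j s (w + single i N)"
proof -
  show "\<not> in_tail_power p x y z W (p + 2 + l) K j s w"
  proof
    assume *: "in_tail_power p x y z W (p + 2 + l) K j s w"
    then have **: "p + 2 + l \<le> K + j" "s \<le> j" "j \<le> p + 1" "(p + 2) * K + s \<le> (p + 2) * Suc l"
      "(p + 1) * j \<le> (p + 2) * p + s" by (simp_all add: in_tail_power_def w)
    then have "Suc l \<le> K" by linarith
    moreover have "(p + 2) * K \<le> (p + 2) * Suc l" using **(4) by linarith
    then have "K \<le> Suc l" by (simp only: mult_le_cancel1)
    ultimately have K: "K = Suc l" by simp
    with ** have "j = p + 1" "s = 0" by simp_all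
    with **(5) show False by simp
  qed
  consider "i = x" | "i = y" | "i = z" | "i \<in> W" using i by blast
  then show "\<exists>N K j s. in_tail_power p x y z W (p + 2 + l) K j s (w + single i N)"
  proof cases
    case 1
    have "in_tail_power p x y z W (p + 2 + l) (Suc l) (p + 1) 1 (w + single i 1)"
      using dist by (simp add: 1 in_tail_power_def lookup_add lookup_single when_def weight_add weight_single w)
    then show ?thesis by blast
  next
    case 2
    have "in_tail_power p x y z W (p + 2 + l) (Suc l) (p + 1) 0 (w + single i 1)"
      using dist by (simp add: 2 in_tail_power_def lookup_add lookup_single when_def weight_add weight_single w)
    then show ?thesis by blast
  next
    case 3
    \<comment> \<open>One factor \<open>x^(p+2)\<close> is given up, and its \<open>p + 2\<close>
      units of \<open>x\<close> are spent on \<open>p + 2\<close> factors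
      \<open>x y^p z\<close>.\<close>
    have "in_tail_power p x y z W (p + 2 + l) l (p + 2) (p + 2) (w + single i 1)"
      using dist by (simp add: 3 in_tail_power_def lookup_add lookup_single when_def weight_add weight_single w)
    then show ?thesis by blast
  next
    case 4
    have "in_tail_power p x y z W (p + 2 + l) 0 0 0 (w + single i (p + 2 + l))"
      using 4 by (simp add: in_tail_power_def lookup_add weight_add weight_single)
    then show ?thesis by blast
  qed
qed

text \<open>The sequence is the free variables followed by \<open>f\<close>, whose regularity is
  only required after the variables in \<open>B\<close> are set to 0.\<close>

lemma depth_quot_ge_Suc:
  fixes f :: "('n::finite, 'k::field) mpoly_ring"
  assumes up: "up_closed U" "0 \<notin> U"
    and free: "\<And>a b. b \<in> B \<Longrightarrow> single b 1 + a \<in> U \<Longrightarrow> a \<in> U"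
    and f: "f \<in> graded_maximal_ideal"
    and reg: "\<And>g. f * g \<in> exp_ideal (U \<union> {a. \<exists>b\<in>B. lookup a b > 0})
      \<Longrightarrow> g \<in> exp_ideal (U \<union> {a. \<exists>b\<in>B. lookup a b > 0})"
  shows "enat (Suc (card B)) \<le> depth_quot (exp_ideal U :: ('n, 'k) mpoly_ring set)"
proof -
  let ?V = "U \<union> {a. \<exists>b\<in>B. lookup a b > 0}"
  obtain bs where bs: "set bs = B" "distinct bs" using finite_distinct_list[of B] by auto
  let ?xs = "map var bs :: ('n, 'k) mpoly_ring list"
  have span: "ideal.span (exp_ideal U \<union> set ?xs) = (exp_ideal ?V :: ('n, 'k) mpoly_ring set)"
    using span_exp_ideal_vars[OF up(1), of B] bs(1) by simp
  have "regular_sequence_quot (exp_ideal U) ?xs"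
    using up bs(2) by (rule regular_sequence_vars) (use free bs(1) in blast)
  moreover have "regular_sequence_quot (exp_ideal U \<union> set ?xs) [f]"
    unfolding regular_sequence_quot_def
  proof (intro conjI allI impI)
    fix i g assume "i < length [f]" "[f] ! i * g \<in> ideal.span (exp_ideal U \<union> set ?xs \<union> set (take i [f]))"
    then show "g \<in> ideal.span (exp_ideal U \<union> set ?xs \<union> set (take i [f]))"
      using reg[of g] span by simp
  next
    have "exp_ideal U \<union> set ?xs \<union> set [f] \<subseteq> {p. lookup p 0 = 0}"
      using up(2) graded_maximal_ideal_constant[OF f] graded_maximal_ideal_constant[OF var_graded_maximal_ideal]
      by (auto simp: exp_ideal_def in_keys_iff)
    then have "ideal.span (exp_ideal U \<union> set ?xs \<union> set [f]) \<subseteq> {p. lookup p 0 = 0}"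
      by (rule ideal.span_minimal[OF _ subspace_zero_constant])
    moreover have "lookup (1 :: ('n, 'k) mpoly_ring) 0 \<noteq> 0" by simp
    ultimately show "ideal.span (exp_ideal U \<union> set ?xs \<union> set [f]) \<noteq> UNIV" by blast
  qed
  ultimately have "regular_sequence_quot (exp_ideal U) (?xs @ [f])" by (rule regular_sequence_append)
  then have "enat (length (?xs @ [f])) \<le> depth_quot (exp_ideal U :: ('n, 'k) mpoly_ring set)"
    using f by (intro depth_quot_ge) (auto simp: var_graded_maximal_ideal)
  then show ?thesis using distinct_card[OF bs(2)] bs(1) by simp
qed

text \<open>The variables are split into \<open>x\<close>, \<open>y\<close>, \<open>z\<close>, a set
  \<open>B\<close> of \<open>d\<close> free ones, and the remaining ones \<open>W\<close>, which are
  generators. From the power \<open>r\<close> on, \<open>tail_power_socle\<close> gives depth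
  \<open>d\<close>; at \<open>r - 1\<close> the element \<open>var y - var z\<close> extends
  \<open>B\<close> to a regular sequence of length \<open>d + 1\<close>.\<close>

lemma codimension_three_exists:
  assumes d: "d + 3 \<le> CARD('n::finite)" and r: "r \<ge> 2"
  shows "\<exists>J :: ('n, 'k::field) mpoly_ring set.
    monomial_ideal J \<and> depth_function J \<longlonglongrightarrow> enat d \<and> dstab J = r"
proof -
  have "3 \<le> card (UNIV :: 'n set)" using d by simp
  then obtain S :: "'n set" where S: "card S = 3" using obtain_subset_with_card_n by blast
  then obtain x y z :: 'n where xyz: "S = {x, y, z}" "x \<noteq> y" "x \<noteq> z" "y \<noteq> z" by (auto simp: card_3_iff)
  have "card (- S) = CARD('n) - 3" using S by (simp add: Compl_eq_Diff_UNIV card_Diff_subset)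
  then have "d \<le> card (- S)" using d by simp
  then obtain B where B: "B \<subseteq> - S" "card B = d" using obtain_subset_with_card_n by blast
  define W where "W = - S - B"
  have dist: "x \<noteq> y" "x \<noteq> z" "y \<noteq> z" "x \<notin> W" "y \<notin> W" "z \<notin> W"
    using xyz by (auto simp: W_def)
  have notB: "i \<in> {x, y, z} \<union> W" if "i \<notin> B" for i using that by (auto simp: W_def xyz(1))
  define p where "p = r - 2"
  have rp: "r = p + 2" using r by (simp add: p_def)
  define U where "U = tail_set p x y z W"
  define J :: "('n, 'k) mpoly_ring set" where "J = exp_ideal U"
  have up: "up_closed U" unfolding U_def by (rule up_closed_tail_set)
  note up' = up_closed_exp_power[OF up]
  note mem = tail_set_power[OF dist, of _ p, folded U_def]
  have "0 \<notin> U" by (simp add: U_def tail_set_def weight_0)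
  note proper = exp_power_proper[OF this]
  have free: "a \<in> exp_power U k" if "b \<in> B" "single b 1 + a \<in> exp_power U k" for a b k
  proof -
    have "b \<notin> {x, y, z} \<union> W" using that(1) B(1) xyz(1) by (auto simp: W_def)
    then have "in_tail_power p x y z W k K j s (single b 1 + a) = in_tail_power p x y z W k K j s a" for K j s
      by (auto simp: in_tail_power_def lookup_add lookup_single when_def weight_add weight_single)
    with that(2) show ?thesis by (simp only: mem)
  qed
  have large: "depth_function J k = enat d" if k: "k \<ge> r" for k
  proof -
    obtain l where l: "k = p + 2 + l" using k rp le_Suc_ex by blast
    define w where "w = single x ((p + 2) * Suc l) + single y ((p + 2) * p) + single z (p + 1)"
    have w: "lookup w x = (p + 2) * Suc l" "lookup w y = (p + 2) * p" "lookup w z = p + 1" "weight W w = 0"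
      using dist by (simp_all add: w_def lookup_add lookup_single when_def weight_add weight_single)
    note socle = tail_power_socle[OF dist w]
    show ?thesis
      unfolding J_def depth_function_exp_ideal[OF up] B(2)[symmetric]
    proof (rule depth_quot_eq_card[OF up' _ free])
      show "0 \<notin> exp_power U k" using k r by (intro proper) simp
      show "w \<notin> exp_power U k" unfolding mem l using socle(1)[of x] by blast
      show "\<exists>N. w + single i N \<in> exp_power U k" if "i \<notin> B" for i
        unfolding mem l by (rule socle(2)[OF notB[OF that]])
    qed
  qed
  have small: "depth_function J (r - 1) \<noteq> enat d"
  proof -
    define k where "k = r - 1"
    have k: "k \<le> p + 1" "k \<ge> 1" using rp by (simp_all add: k_def)
    let ?V = "exp_power U k \<union> {a. \<exists>b\<in>B. lookup a b > 0}"
    have "enat (Suc (card B)) \<le> depth_quot (exp_ideal (exp_power U k) :: ('n, 'k) mpoly_ring set)"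
    proof (rule depth_quot_ge_Suc[OF up' proper[OF k(2)] free, where f = "var y - var z"])
      show "var y - var z \<in> (graded_maximal_ideal :: ('n, 'k) mpoly_ring set)"
        using var_graded_maximal_ideal unfolding graded_maximal_ideal_def by (intro ideal.span_diff)
      fix g :: "('n, 'k) mpoly_ring"
      assume "(var y - var z) * g \<in> exp_ideal ?V"
      then show "g \<in> exp_ideal ?V"
      proof (rule var_diff_regular[OF dist(3) up_closed_Un_var[OF up'], rotated])
        fix a a' t
        assume *: "a \<notin> ?V" "a' \<notin> ?V" "single y 1 + a \<in> ?V" "single z 1 + a' \<in> ?V"
          "a + single z t = a' + single y t"
        have yz: "y \<notin> B" "z \<notin> B" using B(1) xyz(1) by auto
        have "lookup (single y 1 + a) b = lookup a b" "lookup (single z 1 + a') b = lookup a' b" if "b \<in> B" for b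
          using that yz by (auto simp: lookup_add lookup_single when_def)
        with * have "single y 1 + a \<in> exp_power U k" "single z 1 + a' \<in> exp_power U k" by auto
        then obtain K1 j1 s1 K2 j2 s2
          where "in_tail_power p x y z W k K1 j1 s1 (single y 1 + a)"
            "in_tail_power p x y z W k K2 j2 s2 (single z 1 + a')"
          unfolding mem by blast
        moreover have "\<not> in_tail_power p x y z W k K j s a'" for K j s
          using *(2) mem[of a' k] by blast
        ultimately have "a \<in> exp_power U k"
          unfolding mem by (rule tail_power_diff_regular[OF dist k(1) _ _ *(5)])
        with *(1) show False by blast
      qed
    qed assumption
    then show ?thesis
      unfolding J_def depth_function_exp_ideal[OF up] by (auto simp: k_def B(2))
  qed
  from large small have "depth_function J \<longlonglongrightarrow> enat d \<and> dstab J = r"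
    using limit_depth_dstab[of r J "enat d"] r by simp
  moreover have "monomial_ideal J" using up monomial_ideal_exp_ideal J_def by blast
  ultimately show ?thesis by blast
qed

theorem theorem2p1:
  assumes "CARD('n::finite) \<ge> 3"
  shows
    "(\<forall>(I :: ('n, 'k::field) mpoly_ring set) (d :: enat) (r :: nat).
        monomial_ideal I \<and> I \<noteq> UNIV \<and> I \<noteq> {0} \<and>
        depth_function I \<longlonglongrightarrow> d \<and> dstab I = r \<longrightarrow>
          (0 \<le> d \<and> d \<le> enat (CARD('n) - 2) \<and> r \<ge> 1) \<or>
          (d = enat (CARD('n) - 1) \<and> r = 1)) \<and>
     (\<forall>(d :: nat) (r :: nat).
        (0 \<le> d \<and> d \<le> CARD('n) - 2 \<and> r \<ge> 1) \<or> (d = CARD('n) - 1 \<and> r = 1) \<longrightarrow>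
          (\<exists>J :: ('n, 'k) mpoly_ring set.
             monomial_ideal J \<and> depth_function J \<longlonglongrightarrow> enat d \<and> dstab J = r))"
proof (intro conjI allI impI)
  fix I :: "('n, 'k) mpoly_ring set" and d :: enat and r :: nat
  assume "monomial_ideal I \<and> I \<noteq> UNIV \<and> I \<noteq> {0} \<and> depth_function I \<longlonglongrightarrow> d \<and> dstab I = r"
  then show "(0 \<le> d \<and> d \<le> enat (CARD('n) - 2) \<and> r \<ge> 1) \<or> (d = enat (CARD('n) - 1) \<and> r = 1)"
    using limit_depth_dstab_restriction[of I d] by auto
next
  fix d r :: nat
  assume "(0 \<le> d \<and> d \<le> CARD('n) - 2 \<and> r \<ge> 1) \<or> (d = CARD('n) - 1 \<and> r = 1)"
  \<comment> \<open>A single family covers \<open>r = 1\<close>; for \<open>r \<ge> 2\<close> the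
    depth has to rise at the last step if \<open>d = n - 2\<close> and to drop if
    \<open>d \<le> n - 3\<close>, which takes two different families.\<close>
  then consider "r = 1" "d \<le> CARD('n) - 1" | "r \<ge> 2" "d = CARD('n) - 2" | "r \<ge> 2" "d + 3 \<le> CARD('n)"
    using assms by linarith
  then show "\<exists>J :: ('n, 'k) mpoly_ring set.
      monomial_ideal J \<and> depth_function J \<longlonglongrightarrow> enat d \<and> dstab J = r"
  proof cases
    case 1
    then show ?thesis using stability_one_exists[of d, where 'n = 'n and 'k = 'k] by simp
  next
    case 2
    then show ?thesis using codimension_two_exists[OF assms, where 'k = 'k] by simp
  next
    case 3
    then show ?thesis using codimension_three_exists[of d r, where 'n = 'n and 'k = 'k] by simp
  qed
qed

end
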